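(* Let $n>5$ and let $R$ be an $(n+1)$-dimensional solvable complex Leibniz algebra whose nilradical is isomorphic to $g^2_{(n,1)}$. Then $R$ has a basis $\{e_1,\dots,e_n,x\}$ such that $\{e_1,\dots,e_n\}$ spans the nilradical with the brackets of $g^2_{(n,1)}$ (given in the context), and the brackets involving $x$ are of one of the following types (brackets involving $x$ not listed, including $[x,x]$ unless listed, are zero; parameters are complex): $R_1(b_4,\dots,b_{n-1})$: $[e_i,x]=-[x,e_i]=e_i+\sum_{t=i+2}^{n-1}b_{t-i+2}e_t$ for $2\le i\le n-1$. $R_2(a_2)$: $[e_1,x]=-[x,e_1]=e_1+a_2e_2$; $[e_i,x]=-[x,e_i]=(i-1)e_i$ for $2\le i\le n-1$; $[e_n,x]=-[x,e_n]=-a_2e_3+2e_n$. $R_3(\gamma_{n-1})$: $[e_1,x]=-[x,e_1]=e_1$; $[e_i,x]=-[x,e_i]=(i+3-n)e_i$ for $2\le i\le n-1$; $[e_n,x]=-[x,e_n]=\gamma_{n-1}e_{n-1}+2e_n$. $R_4(\delta_{n-1})$: $[e_1,x]=-[x,e_1]=e_1$; $[e_i,x]=-[x,e_i]=(i+1-n)e_i$ for $2\le i\le n-1$; $[e_n,x]=-[x,e_n]=2e_n$; $[x,x]=\delta_{n-1}e_{n-1}$. $R_5(b_2)$, with $b_2\notin\{1,\,5-n,\,3-n\}$: $[e_1,x]=-[x,e_1]=e_1$; $[e_i,x]=-[x,e_i]=(i-2+b_2)e_i$ for $2\le i\le n-1$; $[e_n,x]=-[x,e_n]=2e_n$.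
   Context: A Leibniz algebra is a complex vector space $L$ with a bilinear bracket satisfying $[u,[v,w]]=[[u,v],w]-[[u,w],v]$ for all $u,v,w$. Lower central series $L^1=L$, $L^{k+1}=[L^k,L]$; derived series $L^{[1]}=L$, $L^{[s+1]}=[L^{[s]},L^{[s]}]$; nilpotent/solvable means some term vanishes. The nilradical is the maximal nilpotent ideal. The Lie algebra $g^2_{(n,1)}$ has basis $\{e_1,\dots,e_n\}$ with nonzero brackets $[e_1,e_i]=-[e_i,e_1]=e_{i+1}$ for $2\le i\le n-2$ and $[e_i,e_n]=-[e_n,e_i]=e_{i+2}$ for $2\le i\le n-3$, all other brackets of basis elements being zero. *)

theory Defs
  imports Complex_Main
begin

definition leibniz_algebra ::
  "(complex \<Rightarrow> 'v::ab_group_add \<Rightarrow> 'v) \<Rightarrow> ('v \<Rightarrow> 'v \<Rightarrow> 'v) \<Rightarrow> bool" where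
  "leibniz_algebra scl br \<longleftrightarrow>
     vector_space scl \<and>
     (\<forall>a b c. br (a + b) c = br a c + br b c) \<and>
     (\<forall>a b c. br a (b + c) = br a b + br a c) \<and>
     (\<forall>k a b. br (scl k a) b = scl k (br a b)) \<and>
     (\<forall>k a b. br a (scl k b) = scl k (br a b)) \<and>
     (\<forall>u v w. br u (br v w) = br (br u v) w - br (br u w) v)"

definition brs ::
  "(complex \<Rightarrow> 'v::ab_group_add \<Rightarrow> 'v) \<Rightarrow> ('v \<Rightarrow> 'v \<Rightarrow> 'v) \<Rightarrow> 'v set \<Rightarrow> 'v set \<Rightarrow> 'v set" where
  "brs scl br A B = module.span scl {br a b | a b. a \<in> A \<and> b \<in> B}"

text \<open>Lower central series of a subalgebra I (index 0 corresponds to I^1).\<close>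
fun lcs ::
  "(complex \<Rightarrow> 'v::ab_group_add \<Rightarrow> 'v) \<Rightarrow> ('v \<Rightarrow> 'v \<Rightarrow> 'v) \<Rightarrow> 'v set \<Rightarrow> nat \<Rightarrow> 'v set" where
  "lcs scl br I 0 = I"
| "lcs scl br I (Suc k) = brs scl br (lcs scl br I k) I"

text \<open>Derived series of the whole algebra (index 0 corresponds to L^[1]).\<close>
fun derived ::
  "(complex \<Rightarrow> 'v::ab_group_add \<Rightarrow> 'v) \<Rightarrow> ('v \<Rightarrow> 'v \<Rightarrow> 'v) \<Rightarrow> nat \<Rightarrow> 'v set" where
  "derived scl br 0 = UNIV"
| "derived scl br (Suc k) = brs scl br (derived scl br k) (derived scl br k)"

definition solvable_alg ::
  "(complex \<Rightarrow> 'v::ab_group_add \<Rightarrow> 'v) \<Rightarrow> ('v \<Rightarrow> 'v \<Rightarrow> 'v) \<Rightarrow> bool" where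
  "solvable_alg scl br \<longleftrightarrow> (\<exists>k. derived scl br k = {0})"

definition is_ideal ::
  "(complex \<Rightarrow> 'v::ab_group_add \<Rightarrow> 'v) \<Rightarrow> ('v \<Rightarrow> 'v \<Rightarrow> 'v) \<Rightarrow> 'v set \<Rightarrow> bool" where
  "is_ideal scl br I \<longleftrightarrow> module.subspace scl I \<and>
     (\<forall>a\<in>I. \<forall>b. br a b \<in> I \<and> br b a \<in> I)"

definition nilpotent_ideal ::
  "(complex \<Rightarrow> 'v::ab_group_add \<Rightarrow> 'v) \<Rightarrow> ('v \<Rightarrow> 'v \<Rightarrow> 'v) \<Rightarrow> 'v set \<Rightarrow> bool" where
  "nilpotent_ideal scl br I \<longleftrightarrow> is_ideal scl br I \<and> (\<exists>k. lcs scl br I k = {0})"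

definition is_nilradical ::
  "(complex \<Rightarrow> 'v::ab_group_add \<Rightarrow> 'v) \<Rightarrow> ('v \<Rightarrow> 'v \<Rightarrow> 'v) \<Rightarrow> 'v set \<Rightarrow> bool" where
  "is_nilradical scl br N \<longleftrightarrow> nilpotent_ideal scl br N \<and>
     (\<forall>J. nilpotent_ideal scl br J \<and> N \<subseteq> J \<longrightarrow> J = N)"

definition g2_br :: "nat \<Rightarrow> (nat \<Rightarrow> 'v::ab_group_add) \<Rightarrow> nat \<Rightarrow> nat \<Rightarrow> 'v" where
  "g2_br n e i j =
     (if i = 1 \<and> 2 \<le> j \<and> j \<le> n - 2 then e (j + 1)
      else if j = 1 \<and> 2 \<le> i \<and> i \<le> n - 2 then - e (i + 1)
      else if 2 \<le> i \<and> i \<le> n - 3 \<and> j = n then e (i + 2)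
      else if i = n \<and> 2 \<le> j \<and> j \<le> n - 3 then - e (j + 2)
      else 0)"

text \<open>e_1..e_n is a basis of the subspace N on which the bracket is that of
g^2_(n,1); i.e. the isomorphism N \<cong> g^2_(n,1) sending e_i to the standard
basis vector.\<close>
definition g2_basis ::
  "(complex \<Rightarrow> 'v::ab_group_add \<Rightarrow> 'v) \<Rightarrow> ('v \<Rightarrow> 'v \<Rightarrow> 'v) \<Rightarrow> nat \<Rightarrow> 'v set \<Rightarrow> (nat \<Rightarrow> 'v) \<Rightarrow> bool" where
  "g2_basis scl br n N e \<longleftrightarrow>
     inj_on e {1..n} \<and> \<not> module.dependent scl (e ` {1..n}) \<and>
     module.span scl (e ` {1..n}) = N \<and>
     (\<forall>i\<in>{1..n}. \<forall>j\<in>{1..n}. br (e i) (e j) = g2_br n e i j)"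

definition isomorphic_g2 ::
  "(complex \<Rightarrow> 'v::ab_group_add \<Rightarrow> 'v) \<Rightarrow> ('v \<Rightarrow> 'v \<Rightarrow> 'v) \<Rightarrow> nat \<Rightarrow> 'v set \<Rightarrow> bool" where
  "isomorphic_g2 scl br n N \<longleftrightarrow> (\<exists>e. g2_basis scl br n N e)"

definition x_brackets ::
  "('v::ab_group_add \<Rightarrow> 'v \<Rightarrow> 'v) \<Rightarrow> nat \<Rightarrow> (nat \<Rightarrow> 'v) \<Rightarrow> 'v \<Rightarrow> (nat \<Rightarrow> 'v) \<Rightarrow> 'v \<Rightarrow> bool" where
  "x_brackets br n e x D xx \<longleftrightarrow>
     (\<forall>i\<in>{1..n}. br (e i) x = D i \<and> br x (e i) = - D i) \<and> br x x = xx"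

definition R1 ::
  "(complex \<Rightarrow> 'v::ab_group_add \<Rightarrow> 'v) \<Rightarrow> ('v \<Rightarrow> 'v \<Rightarrow> 'v) \<Rightarrow> nat \<Rightarrow> (nat \<Rightarrow> 'v) \<Rightarrow> 'v \<Rightarrow> (nat \<Rightarrow> complex) \<Rightarrow> bool" where
  "R1 scl br n e x b \<longleftrightarrow> x_brackets br n e x
     (\<lambda>i. if 2 \<le> i \<and> i \<le> n - 1
          then e i + (\<Sum>t = i + 2..n - 1. scl (b (t - i + 2)) (e t))
          else 0) 0"

definition R2 ::
  "(complex \<Rightarrow> 'v::ab_group_add \<Rightarrow> 'v) \<Rightarrow> ('v \<Rightarrow> 'v \<Rightarrow> 'v) \<Rightarrow> nat \<Rightarrow> (nat \<Rightarrow> 'v) \<Rightarrow> 'v \<Rightarrow> complex \<Rightarrow> bool" where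
  "R2 scl br n e x a2 \<longleftrightarrow> x_brackets br n e x
     (\<lambda>i. if i = 1 then e 1 + scl a2 (e 2)
          else if i = n then - scl a2 (e 3) + scl 2 (e n)
          else scl (of_nat i - 1) (e i)) 0"

definition R3 ::
  "(complex \<Rightarrow> 'v::ab_group_add \<Rightarrow> 'v) \<Rightarrow> ('v \<Rightarrow> 'v \<Rightarrow> 'v) \<Rightarrow> nat \<Rightarrow> (nat \<Rightarrow> 'v) \<Rightarrow> 'v \<Rightarrow> complex \<Rightarrow> bool" where
  "R3 scl br n e x \<gamma> \<longleftrightarrow> x_brackets br n e x
     (\<lambda>i. if i = 1 then e 1
          else if i = n then scl \<gamma> (e (n - 1)) + scl 2 (e n)
          else scl (of_nat i + 3 - of_nat n) (e i)) 0"

definition R4 ::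
  "(complex \<Rightarrow> 'v::ab_group_add \<Rightarrow> 'v) \<Rightarrow> ('v \<Rightarrow> 'v \<Rightarrow> 'v) \<Rightarrow> nat \<Rightarrow> (nat \<Rightarrow> 'v) \<Rightarrow> 'v \<Rightarrow> complex \<Rightarrow> bool" where
  "R4 scl br n e x \<delta> \<longleftrightarrow> x_brackets br n e x
     (\<lambda>i. if i = 1 then e 1
          else if i = n then scl 2 (e n)
          else scl (of_nat i + 1 - of_nat n) (e i)) (scl \<delta> (e (n - 1)))"

definition R5 ::
  "(complex \<Rightarrow> 'v::ab_group_add \<Rightarrow> 'v) \<Rightarrow> ('v \<Rightarrow> 'v \<Rightarrow> 'v) \<Rightarrow> nat \<Rightarrow> (nat \<Rightarrow> 'v) \<Rightarrow> 'v \<Rightarrow> complex \<Rightarrow> bool" where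
  "R5 scl br n e x b2 \<longleftrightarrow> b2 \<notin> {1, 5 - of_nat n, 3 - of_nat n} \<and> x_brackets br n e x
     (\<lambda>i. if i = 1 then e 1
          else if i = n then scl 2 (e n)
          else scl (of_nat i - 2 + b2) (e i)) 0"

end

theory Submission
  imports Defs
begin

text \<open>Right multiplication by an element \<open>x\<close> outside the nilradical \<open>N\<close> is a
  derivation \<open>D\<close> of \<open>N\<close>. Write \<open>A\<close> for the span of \<open>e\<^sub>2,
  \<dots>, e\<^bsub>n-1\<^esub>\<close>, on which \<open>e\<^sub>1\<close> acts as a nilpotent shift
  \<open>S\<close> and \<open>e\<^sub>n\<close> as \<open>- S\<^sup>2\<close>. The derivation law forces, with
  two numbers \<open>\<alpha>\<close> and \<open>\<beta>\<close>, eigenvalues \<open>\<alpha>\<close> on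
  \<open>e\<^sub>1\<close>, \<open>2 \<alpha>\<close> on \<open>e\<^sub>n\<close> (both modulo
  \<open>A\<close>) and \<open>(i - 2) \<alpha> + \<beta>\<close> on \<open>e\<^sub>i\<close> (modulo later
  basis vectors), and maximality of \<open>N\<close> excludes \<open>\<alpha> = \<beta> = 0\<close>. The
  elements \<open>[x,v] + [v,x]\<close> and \<open>[x,x]\<close> annihilate the algebra from the right, so
  they lie in the centre of \<open>N\<close>, the line through \<open>e\<^bsub>n-1\<^esub>\<close>; comparing
  eigenvalues, the former vanish, and the latter does unless \<open>D e\<^bsub>n-1\<^esub> = 0\<close>. If
  \<open>\<alpha> = 0\<close>, then \<open>D\<close> is invertible on \<open>A\<close> and its values on
  \<open>e\<^sub>1\<close> and \<open>e\<^sub>n\<close> can be removed, which gives \<open>R\<^sub>1\<close>.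
  Otherwise scale to \<open>\<alpha> = 1\<close> and diagonalise \<open>D\<close> on \<open>A\<close>; the
  remaining coefficients can be removed except at the resonances \<open>\<beta> = 1\<close>, \<open>\<beta> =
  5 - n\<close> and \<open>\<beta> = 3 - n\<close>, which give \<open>R\<^sub>2\<close>,
  \<open>R\<^sub>3\<close> and \<open>R\<^sub>4\<close>.\<close>

section \<open>Bracket calculus in a Leibniz algebra and the filtration by tails of a
  sequence\<close>

locale leibniz = vector_space scl
  for scl :: "complex \<Rightarrow> 'v::ab_group_add \<Rightarrow> 'v" (infixr "*s" 75) +
  fixes br :: "'v \<Rightarrow> 'v \<Rightarrow> 'v"
  assumes br_add_left: "br (a + b) c = br a c + br b c"
    and br_add_right: "br a (b + c) = br a b + br a c"
    and br_scale_left: "br (k *s a) b = k *s br a b"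
    and br_scale_right: "br a (k *s b) = k *s br a b"
    and leibniz_identity: "br a (br b c) = br (br a b) c - br (br a c) b"
begin

lemma br_zero_left [simp]: "br 0 a = 0"
  using br_scale_left[of 0 0 a] by simp

lemma br_zero_right [simp]: "br a 0 = 0"
  using br_scale_right[of a 0 0] by simp

lemma br_minus_left: "br (- a) b = - br a b"
  using br_scale_left[of "-1" a b] by simp

lemma br_minus_right: "br a (- b) = - br a b"
  using br_scale_right[of a "-1" b] by simp

lemma br_diff_left: "br (a - b) c = br a c - br b c"
  using br_add_left[of a "- b" c] by (simp add: br_minus_left)

lemma br_diff_right: "br a (b - c) = br a b - br a c"
  using br_add_right[of a b "- c"] by (simp add: br_minus_right)

lemmas br_linear = br_add_left br_add_right br_scale_left br_scale_right
  br_minus_left br_minus_right br_diff_left br_diff_right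

lemmas scl_linear = scale_left_distrib scale_right_distrib
  scale_left_diff_distrib scale_right_diff_distrib

lemma br_right_derivation: "br (br a b) c = br a (br b c) + br (br a c) b"
  by (simp add: leibniz_identity)

text \<open>The right-hand side of the Leibniz identity changes sign when its last two arguments are
  swapped.\<close>

lemma br_symmetric_part_annihilates: "br c (br a b + br b a) = 0"
  by (simp add: br_add_right leibniz_identity)

lemma br_square_annihilates: "br c (br a a) = 0"
  by (simp add: leibniz_identity)

lemma subspace_br_right: "subspace T \<Longrightarrow> subspace {v. br a v \<in> T}"
  by (auto simp: subspace_def br_linear)

lemma subspace_br_left: "subspace T \<Longrightarrow> subspace {v. br v a \<in> T}"
  by (auto simp: subspace_def br_linear)

text \<open>The index set has no upper bound, so shifting a tail needs no side condition. For a
  frame \<open>f\<close> the tails descend to zero at index \<open>m\<close>.\<close>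

definition tail :: "(nat \<Rightarrow> 'v) \<Rightarrow> nat \<Rightarrow> 'v set" where
  "tail f s = span (f ` {s..})"

lemma subspace_tail [simp]: "subspace (tail f s)"
  by (simp add: tail_def)

lemma tail_mono: "s \<le> t \<Longrightarrow> tail f t \<subseteq> tail f s"
  unfolding tail_def by (rule span_mono) auto

lemma tail_antimono: "v \<in> tail f t \<Longrightarrow> s \<le> t \<Longrightarrow> v \<in> tail f s"
  using tail_mono by blast

lemma in_tail: "s \<le> k \<Longrightarrow> f k \<in> tail f s"
  unfolding tail_def by (rule span_base) auto

lemma tail_breakdown: "v \<in> tail f s \<Longrightarrow> \<exists>r. v - r *s f s \<in> tail f (Suc s)"
proof -
  have "{s..} = insert s {Suc s..}" by auto
  then show "v \<in> tail f s \<Longrightarrow> ?thesis"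
    by (simp add: tail_def span_breakdown_eq)
qed

lemma tail_subset: "subspace T \<Longrightarrow> (\<And>k. s \<le> k \<Longrightarrow> f k \<in> T) \<Longrightarrow> tail f s \<subseteq> T"
  unfolding tail_def by (rule span_minimal) auto

lemmas tail_closed [intro, simp] =
  subspace_add[OF subspace_tail] subspace_diff[OF subspace_tail]
  subspace_scale[OF subspace_tail] subspace_neg[OF subspace_tail]
  subspace_0[OF subspace_tail]

text \<open>Supplies the coefficients that become the parameters of \<open>R1\<close>; vectors from
  index \<open>m\<close> on are zero, so a finite sum is enough.\<close>

lemma tail_sum:
  assumes v: "v \<in> tail f s" and z: "\<And>k. m \<le> k \<Longrightarrow> f k = 0"
  shows "\<exists>p. v = (\<Sum>j=s..<m. p j *s f j)"
proof -
  have "tail f s \<subseteq> {v. \<exists>p. v = (\<Sum>j=s..<m. p j *s f j)}"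
  proof (rule tail_subset)
    show "f k \<in> {v. \<exists>p. v = (\<Sum>j=s..<m. p j *s f j)}" if "s \<le> k" for k
    proof -
      have "(\<Sum>j=s..<m. (if j = k then 1 else 0) *s f j) = (\<Sum>j=s..<m. if j = k then f j else 0)"
        by (rule sum.cong) auto
      with that show ?thesis
        by (intro CollectI exI[of _ "\<lambda>j. if j = k then 1 else 0"]) (simp add: z)
    qed
    show "subspace {v. \<exists>p. v = (\<Sum>j=s..<m. p j *s f j)}"
      unfolding subspace_def
    proof (intro conjI ballI allI, goal_cases)
      case 1
      show ?case by (auto intro!: exI[of _ "\<lambda>_. 0"])
    next
      case (2 a b)
      then obtain p q where "a = (\<Sum>j=s..<m. p j *s f j)" "b = (\<Sum>j=s..<m. q j *s f j)" by auto
      then show ?case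
        by (auto intro!: exI[of _ "\<lambda>j. p j + q j"] simp: scale_left_distrib sum.distrib)
    next
      case (3 c a)
      then obtain p where "a = (\<Sum>j=s..<m. p j *s f j)" by auto
      then show ?case
        by (auto intro!: exI[of _ "\<lambda>j. c * p j"] simp: scale_sum_right)
    qed
  qed
  with v show ?thesis by auto
qed

text \<open>A vector of \<open>span E\<close> outside \<open>span B\<close> could be added to
  \<open>B\<close>, giving an independent set in \<open>span E\<close> with more elements than
  \<open>E\<close>.\<close>

lemma independent_span_eq:
  assumes "independent B" "finite B" "finite E" "card E = card B" "B \<subseteq> span E"
  shows "span B = span E"
proof
  show "span B \<subseteq> span E" using assms(5) by (simp add: span_minimal)
  show "span E \<subseteq> span B"
  proof (rule ccontr)
    assume "\<not> ?thesis"
    then obtain v where v: "v \<in> span E" "v \<notin> span B" by auto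
    then have "independent (insert v B)" "v \<notin> B"
      using assms(1) by (auto simp: independent_insert span_base)
    moreover have "insert v B \<subseteq> span E" using v assms(5) by auto
    ultimately have "card (insert v B) \<le> card E"
      using independent_span_bound[OF assms(3)] by auto
    then show False using assms \<open>v \<notin> B\<close> by simp
  qed
qed

end

section \<open>The algebra around its nilradical\<close>

definition standard_basis :: "nat \<Rightarrow> 'v \<Rightarrow> 'v \<Rightarrow> (nat \<Rightarrow> 'v) \<Rightarrow> nat \<Rightarrow> 'v" where
  "standard_basis n u w f i = (if i = 1 then u else if i = n then w else f (i - 2))"

text \<open>The assumption \<open>not_nilpotent\<close> records the maximality of the nilradical,
  and \<open>codim_N\<close> that its codimension is at most one.\<close>

locale ambient = leibniz scl br
  for scl :: "complex \<Rightarrow> 'v::ab_group_add \<Rightarrow> 'v" (infixr "*s" 75)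
    and br :: "'v \<Rightarrow> 'v \<Rightarrow> 'v" +
  fixes m :: nat and N :: "'v set"
  assumes m: "4 \<le> m"
    and subspace_N: "subspace N"
    and br_N_left: "a \<in> N \<Longrightarrow> br a b \<in> N"
    and br_N_right: "a \<in> N \<Longrightarrow> br b a \<in> N"
    and dim_N: "\<exists>E. finite E \<and> card E = m + 2 \<and> span E = N"
    and not_nilpotent: "lcs scl br UNIV k \<noteq> {0}"
    and codim_N: "x \<notin> N \<Longrightarrow> \<exists>k. v - k *s x \<in> N"
begin

lemmas N_closed [intro, simp] =
  subspace_add[OF subspace_N] subspace_diff[OF subspace_N]
  subspace_scale[OF subspace_N] subspace_neg[OF subspace_N] subspace_0[OF subspace_N]

end

text \<open>Here \<open>m = n - 2\<close>. With \<open>u = e\<^sub>1\<close>, \<open>w = e\<^sub>n\<close> and \<open>f k = e\<^bsub>k+2\<^esub>\<close>, extended by zero for \<open>k \<ge> m\<close>, the brackets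
  of \<open>g\<^sup>2\<^bsub>(n,1)\<^esub>\<close> hold without index restrictions. The condition \<open>f (m - 1) \<noteq> 0\<close> replaces linear
  independence, which it implies by means of the brackets.\<close>
locale g2_frame = ambient scl br m N
  for scl :: "complex \<Rightarrow> 'v::ab_group_add \<Rightarrow> 'v" (infixr "*s" 75)
    and br :: "'v \<Rightarrow> 'v \<Rightarrow> 'v" and m N +
  fixes u w :: 'v and f :: "nat \<Rightarrow> 'v"
  assumes f_zero: "m \<le> k \<Longrightarrow> f k = 0"
    and f_last: "f (m - 1) \<noteq> 0"
    and u_N: "u \<in> N" and w_N: "w \<in> N" and f_N: "f k \<in> N"
    and uu [simp]: "br u u = 0" and ww [simp]: "br w w = 0"
    and uw [simp]: "br u w = 0" and wu [simp]: "br w u = 0"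
    and uf [simp]: "br u (f k) = f (Suc k)" and fu [simp]: "br (f k) u = - f (Suc k)"
    and fw [simp]: "br (f k) w = f (Suc (Suc k))" and wf [simp]: "br w (f k) = - f (Suc (Suc k))"
    and ff [simp]: "br (f i) (f j) = 0"
begin

section \<open>Structure of the nilradical in terms of a frame\<close>

abbreviation "A \<equiv> tail f 0"

lemma A_subset_N: "A \<subseteq> N"
  by (rule tail_subset) (auto simp: subspace_N f_N)

lemma tail_zero: "m \<le> s \<Longrightarrow> tail f s = {0}"
  using tail_subset[of "{0}" s f] by (auto simp: f_zero)

lemma tail_A: "v \<in> tail f s \<Longrightarrow> v \<in> A"
  by (rule tail_antimono) auto

lemma u_tail: "v \<in> tail f s \<Longrightarrow> br u v \<in> tail f (Suc s)"
proof -
  have "tail f s \<subseteq> {v. br u v \<in> tail f (Suc s)}"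
    by (rule tail_subset) (auto simp: subspace_br_right intro: in_tail)
  then show "v \<in> tail f s \<Longrightarrow> ?thesis" by auto
qed

lemma u_A: "v \<in> A \<Longrightarrow> br u v \<in> A"
  using u_tail tail_A by blast

lemma A_u: "v \<in> A \<Longrightarrow> br v u = - br u v"
proof -
  have "A \<subseteq> {v. br v u = - br u v}"
    by (rule tail_subset) (auto simp: subspace_def br_linear)
  then show "v \<in> A \<Longrightarrow> ?thesis" by auto
qed

lemma A_w: "v \<in> A \<Longrightarrow> br v w = br u (br u v)"
proof -
  have "A \<subseteq> {v. br v w = br u (br u v)}"
    by (rule tail_subset) (auto simp: subspace_def br_linear)
  then show "v \<in> A \<Longrightarrow> ?thesis" by auto
qed

lemma w_A: "v \<in> A \<Longrightarrow> br w v = - br u (br u v)"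
proof -
  have "A \<subseteq> {v. br w v = - br u (br u v)}"
    by (rule tail_subset) (auto simp: subspace_def br_linear)
  then show "v \<in> A \<Longrightarrow> ?thesis" by auto
qed

lemma A_A: "v \<in> A \<Longrightarrow> v' \<in> A \<Longrightarrow> br v v' = 0"
proof -
  have "A \<subseteq> {v'. br (f k) v' = 0}" for k
    by (rule tail_subset) (auto simp: subspace_def br_linear)
  then have "A \<subseteq> {v. br v v' = 0}" if "v' \<in> A" for v'
    using that by (intro tail_subset) (auto simp: subspace_def br_linear)
  then show "v \<in> A \<Longrightarrow> v' \<in> A \<Longrightarrow> ?thesis" by auto
qed

lemma f_A [simp]: "f k \<in> A"
  by (rule in_tail) simp

lemma u_pow_f: "(br u ^^ i) (f k) = f (i + k)"
  by (induction i) auto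

lemma u_pow_scale: "(br u ^^ i) (r *s v) = r *s (br u ^^ i) v"
  by (induction i) (auto simp: br_linear)

lemma u_pow_diff: "(br u ^^ i) (a - b) = (br u ^^ i) a - (br u ^^ i) b"
  by (induction i) (auto simp: br_linear)

lemma u_pow_tail: "v \<in> tail f s \<Longrightarrow> (br u ^^ i) v \<in> tail f (i + s)"
  by (induction i) (auto simp: u_tail)

text \<open>Applying \<open>br u\<close> exactly \<open>m - 1 - k\<close> times moves
  \<open>f k\<close> to the nonzero vector \<open>f (m - 1)\<close> and the later tail to zero. This
  stands in for linear independence when leading coefficients are compared.\<close>

lemma f_notin_tail:
  assumes "k < m" "r *s f k \<in> tail f (Suc k)"
  shows "r = 0"
proof -
  have "(br u ^^ (m - 1 - k)) (r *s f k) \<in> tail f ((m - 1 - k) + Suc k)"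
    using assms by (intro u_pow_tail)
  also have "\<dots> = {0}" using assms by (intro tail_zero) auto
  finally have "r *s f (m - 1) = 0" using assms by (simp add: u_pow_scale u_pow_f)
  then show ?thesis using f_last by auto
qed

lemma f_nonzero: "k < m \<Longrightarrow> f k \<noteq> 0"
  using f_notin_tail[of k 1] by auto

text \<open>Bracketing with \<open>f k\<close> removes \<open>v\<close>, since \<open>A\<close> is
  abelian. At \<open>k = m - 2\<close> the second term is \<open>f m = 0\<close>, which isolates
  \<open>p\<close>; then \<open>k = m - 3\<close> isolates \<open>q\<close>.\<close>

lemma uw_indep:
  assumes "p *s u + q *s w + v = 0" "v \<in> A"
  shows "p = 0" "q = 0" "v = 0"
proof -
  have "br (p *s u + q *s w + v) (f k) = p *s f (Suc k) - q *s f (Suc (Suc k))" for k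
    using assms(2) by (simp add: br_linear A_A)
  then have *: "p *s f (Suc k) - q *s f (Suc (Suc k)) = 0" for k using assms by simp
  have "Suc (m - 2) = m - 1" using m by auto
  then have "p *s f (m - 1) = 0" using *[of "m - 2"] m by (simp add: f_zero)
  then show "p = 0" using f_last by auto
  moreover have "Suc (Suc (m - 3)) = m - 1" using m by auto
  ultimately have "q *s f (m - 1) = 0" using *[of "m - 3"] by simp
  then show "q = 0" using f_last by auto
  with \<open>p = 0\<close> show "v = 0" using assms by simp
qed

text \<open>The shift sends the leading term at \<open>f s\<close> to one at
  \<open>f (Suc s)\<close>, which is nonzero for \<open>s < m - 1\<close>; so leading coefficients
  vanish one after another.\<close>

lemma u_ker:
  assumes "v \<in> A" "br u v = 0"
  shows "\<exists>r. v = r *s f (m - 1)"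
proof -
  have "s \<le> m - 1 \<Longrightarrow> v \<in> tail f s" for s
  proof (induction s)
    case 0
    then show ?case using assms by simp
  next
    case (Suc s)
    then obtain r where r: "v - r *s f s \<in> tail f (Suc s)" using tail_breakdown by force
    then have "br u (v - r *s f s) \<in> tail f (Suc (Suc s))" by (rule u_tail)
    then have "- (r *s f (Suc s)) \<in> tail f (Suc (Suc s))" using assms by (simp add: br_linear)
    then have "r *s f (Suc s) \<in> tail f (Suc (Suc s))" using tail_closed(4) by fastforce
    then have "r = 0" using Suc.prems m by (intro f_notin_tail) auto
    then show ?case using r by simp
  qed
  then have "v \<in> tail f (m - 1)" by simp
  then obtain r where "v - r *s f (m - 1) \<in> tail f (Suc (m - 1))" using tail_breakdown by blast
  then show ?thesis using m by (auto simp: tail_zero)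
qed

lemma tail_finite: "tail f s = span (f ` {s..<m})"
proof
  show "tail f s \<subseteq> span (f ` {s..<m})"
  proof (rule tail_subset)
    fix k assume "s \<le> k"
    then show "f k \<in> span (f ` {s..<m})"
      by (cases "k < m") (auto simp: f_zero span_zero intro: span_base)
  qed simp
  show "span (f ` {s..<m}) \<subseteq> tail f s"
    unfolding tail_def by (rule span_mono) auto
qed

lemma f_independent: "s \<le> m \<Longrightarrow> independent (f ` {s..<m}) \<and> card (f ` {s..<m}) = m - s"
proof (induction s rule: inc_induct)
  case base
  then show ?case by (simp add: independent_empty)
next
  case (step k)
  have *: "f k \<notin> span (f ` {Suc k..<m})"
    using f_notin_tail[of k 1] step by (auto simp: tail_finite)
  then have "f k \<notin> f ` {Suc k..<m}" using span_base by blast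
  moreover have "{k..<m} = insert k {Suc k..<m}" using step by auto
  ultimately show ?case using step * by (simp add: independent_insert)
qed

lemma frame_independent:
  "independent (insert u (insert w (f ` {..<m})))"
  "card (insert u (insert w (f ` {..<m}))) = m + 2"
proof -
  have f: "independent (f ` {..<m})" "card (f ` {..<m}) = m"
    using f_independent[of 0] by (auto simp: lessThan_atLeast0)
  have A: "A = span (f ` {..<m})" by (simp add: tail_finite lessThan_atLeast0)
  have w: "w \<notin> span (f ` {..<m})"
    using uw_indep(2)[of 0 1 "- w"] A by auto
  have u: "u \<notin> span (insert w (f ` {..<m}))"
  proof
    assume "u \<in> span (insert w (f ` {..<m}))"
    then obtain k where "u - k *s w \<in> A" by (auto simp: span_breakdown_eq A)
    then show False using uw_indep(1)[of "-1" k "u - k *s w"] by auto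
  qed
  show "independent (insert u (insert w (f ` {..<m})))"
    using u w f by (simp add: independent_insert)
  have "w \<notin> f ` {..<m}" "u \<notin> insert w (f ` {..<m})"
    using u w by (meson span_base)+
  then show "card (insert u (insert w (f ` {..<m}))) = m + 2" using f by simp
qed

lemma frame_span: "span (insert u (insert w (f ` {..<m}))) = N"
proof -
  obtain E where E: "finite E" "card E = m + 2" "span E = N" using dim_N by auto
  have "insert u (insert w (f ` {..<m})) \<subseteq> span E"
    using u_N w_N f_N E by auto
  then show ?thesis
    using E frame_independent by (metis independent_span_eq finite_imageI finite_insert finite_lessThan)
qed

lemma g2_basis_standard_basis: "g2_basis scl br (m + 2) N (standard_basis (m + 2) u w f)"
proof -
  define e where "e = standard_basis (m + 2) u w f"
  have e1: "e 1 = u" and en: "e (m + 2) = w" and ek: "k < m \<Longrightarrow> e (k + 2) = f k" for k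
    by (auto simp: e_def standard_basis_def)
  have "{1..m + 2} = insert 1 (insert (m + 2) ((\<lambda>k. k + 2) ` {..<m}))"
  proof (intro set_eqI iffI)
    fix i assume "i \<in> {1..m + 2}"
    then show "i \<in> insert 1 (insert (m + 2) ((\<lambda>k. k + 2) ` {..<m}))"
      by (cases "i = 1"; cases "i = m + 2") (auto intro!: image_eqI[of _ _ "i - 2"])
  qed auto
  moreover have "e ` (\<lambda>k. k + 2) ` {..<m} = f ` {..<m}"
    unfolding image_image by (rule image_cong) (use ek in auto)
  ultimately have im: "e ` {1..m + 2} = insert u (insert w (f ` {..<m}))"
    by (simp only: image_insert e1 en)
  have "br (e i) (e j) = g2_br (m + 2) e i j" if ij: "i \<in> {1..m + 2}" "j \<in> {1..m + 2}" for i j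
  proof -
    have cases: "i = 1 \<or> i = m + 2 \<or> (\<exists>k<m. i = k + 2)" if "i \<in> {1..m + 2}" for i
      using that by (cases "i = 1"; cases "i = m + 2") (auto intro!: exI[of _ "i - 2"])
    have "e (Suc (Suc k)) = f k" if "k < m" for k using ek[OF that] by simp
    then show ?thesis using cases[OF ij(1)] cases[OF ij(2)] m
      by (elim disjE exE conjE) (auto simp: g2_br_def e1 en e1[simplified] en[simplified] f_zero)
  qed
  then show ?thesis
    unfolding g2_basis_def e_def[symmetric] im
    using frame_independent frame_span im by (auto intro!: eq_card_imp_inj_on)
qed

lemma N_decomp: "v \<in> N \<Longrightarrow> \<exists>p q. \<exists>a\<in>A. v = p *s u + q *s w + a"
proof -
  assume "v \<in> N"
  then have "v \<in> span (insert u (insert w (f ` {..<m})))" by (simp add: frame_span)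
  then obtain p q where *: "v - p *s u - q *s w \<in> span (f ` {..<m})"
    by (auto simp: span_breakdown_eq)
  then have "v - p *s u - q *s w \<in> A" by (simp add: tail_finite lessThan_atLeast0)
  then show ?thesis
    by (intro exI[of _ p] exI[of _ q] bexI[of _ "v - p *s u - q *s w"]) auto
qed

lemma br_N_explicit:
  assumes "a \<in> A" "a' \<in> A"
  shows "br (p *s u + q *s w + a) (p' *s u + q' *s w + a') =
    p *s br u a' - q *s br u (br u a') - p' *s br u a + q' *s br u (br u a)"
  using assms by (simp add: br_add_left br_add_right br_scale_left br_scale_right
      A_A A_u A_w w_A)

lemma N_anticommute:
  assumes "a \<in> N" "b \<in> N"
  shows "br a b = - br b a"
proof -
  obtain p q a' where a: "a = p *s u + q *s w + a'" "a' \<in> A" using N_decomp[OF assms(1)] by auto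
  obtain p' q' b' where b: "b = p' *s u + q' *s w + b'" "b' \<in> A" using N_decomp[OF assms(2)] by auto
  show ?thesis unfolding a(1) b(1) br_N_explicit[OF a(2) b(2)] br_N_explicit[OF b(2) a(2)]
    by simp
qed

lemma N_br_tail:
  assumes "a \<in> tail f s" "b \<in> N"
  shows "br a b \<in> tail f (Suc s)"
proof -
  obtain p' q' b' where b: "b = p' *s u + q' *s w + b'" "b' \<in> A" using N_decomp[OF assms(2)] by auto
  have "br a b = - (p' *s br u a) + q' *s br u (br u a)"
    using br_N_explicit[OF tail_A[OF assms(1)] b(2), of 0 0 p' q'] by (simp add: b(1))
  moreover have "br u (br u a) \<in> tail f (Suc s)"
    by (rule tail_antimono[OF u_tail[OF u_tail]]) (use assms in auto)
  ultimately show ?thesis using u_tail[OF assms(1)] by (metis tail_closed(1,3,4))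
qed

lemma N_br_A:
  assumes "a \<in> N" "b \<in> N"
  shows "br a b \<in> A"
proof -
  obtain p q a' where a: "a = p *s u + q *s w + a'" "a' \<in> A" using N_decomp[OF assms(1)] by auto
  obtain p' q' b' where b: "b = p' *s u + q' *s w + b'" "b' \<in> A" using N_decomp[OF assms(2)] by auto
  have "br u a' \<in> A" "br u (br u a') \<in> A" "br u b' \<in> A" "br u (br u b') \<in> A"
    using a b by (simp_all add: u_A)
  then show ?thesis unfolding a(1) b(1) br_N_explicit[OF a(2) b(2)]
    by (intro tail_closed)
qed

text \<open>Brackets with the \<open>f k\<close> kill the coefficients of \<open>u\<close> and
  \<open>w\<close>, as in \<open>uw_indep\<close>; the bracket with \<open>u\<close> then leaves the
  kernel of the shift.\<close>

lemma N_center: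
  assumes "v \<in> N" "\<And>a. a \<in> N \<Longrightarrow> br a v = 0"
  shows "\<exists>r. v = r *s f (m - 1)"
proof -
  obtain p q a where v: "v = p *s u + q *s w + a" and a: "a \<in> A"
    using N_decomp[OF assms(1)] by auto
  have *: "q *s f (Suc (Suc k)) - p *s f (Suc k) = 0" for k
    using assms(2)[OF f_N, of k] a by (simp add: v br_linear A_A)
  have "Suc (m - 2) = m - 1" using m by auto
  then have "p *s f (m - 1) = 0" using *[of "m - 2"] m by (simp add: f_zero)
  then have p: "p = 0" using f_last by auto
  moreover have "Suc (Suc (m - 3)) = m - 1" using m by auto
  ultimately have "q *s f (m - 1) = 0" using *[of "m - 3"] by simp
  then have q: "q = 0" using f_last by auto
  have "br u a = 0" using assms(2)[OF u_N] by (simp add: v p q)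
  then show ?thesis using u_ker[OF a] by (simp add: v p q)
qed

lemma last_central: "a \<in> N \<Longrightarrow> br a (f (m - 1)) = 0" "a \<in> N \<Longrightarrow> br (f (m - 1)) a = 0"
proof -
  have "f (Suc (m - 1)) = 0" "f (Suc (Suc (m - 1))) = 0" by (simp_all add: f_zero)
  then show "a \<in> N \<Longrightarrow> br a (f (m - 1)) = 0" "a \<in> N \<Longrightarrow> br (f (m - 1)) a = 0"
    using N_decomp[of a] by (auto simp: br_add_left br_add_right br_scale_left br_scale_right A_A)
qed

section \<open>Changes of frame and the shape of a derivation of the nilradical\<close>

lemma tail_breakdownE:
  assumes "v \<in> tail f s"
  obtains r t where "v = r *s f s + t" "t \<in> tail f (Suc s)"
  using tail_breakdown[OF assms] by (metis add.commute diff_add_cancel)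

text \<open>As \<open>A\<close> is abelian, adding elements of it to \<open>u\<close> and
  \<open>w\<close> does not alter their action on \<open>A\<close>. The term \<open>- br u v\<close>
  keeps \<open>[u + v, w]\<close> zero, and \<open>f (m - 1)\<close> is central, so
  \<open>\<nu>\<close> is free.\<close>

lemma frame_change:
  assumes "v \<in> A" "g - f 0 \<in> tail f 1"
  shows "g2_frame scl br m N (u + v) (w - br u v + \<nu> *s f (m - 1)) (\<lambda>k. (br u ^^ k) g)"
proof -
  define f' where "f' = (\<lambda>k. (br u ^^ k) g)"
  define z where "z = \<nu> *s f (m - 1) - br u v"
  have g: "g \<in> A"
    using subspace_add[OF subspace_tail tail_A[OF assms(2)] f_A[of 0]] by simp
  have f'_A: "f' k \<in> A" for k using u_pow_tail[OF g, of k] tail_A by (simp add: f'_def)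
  have f'_Suc: "br u (f' k) = f' (Suc k)" for k by (simp add: f'_def)
  have z: "z \<in> A" using assms by (simp add: u_A z_def)
  have "br u (f (m - 1)) = 0" using f_zero[of m] m by simp
  then have uz: "br u z = - br u (br u v)"
    by (simp add: z_def br_diff_right br_scale_right)
  have "(br u ^^ (m - 1)) (g - f 0) \<in> tail f ((m - 1) + 1)"
    using assms by (intro u_pow_tail)
  then have last: "f' (m - 1) = f (m - 1)"
    using m by (simp add: tail_zero u_pow_diff u_pow_f f'_def)
  have f'_zero: "f' k = 0" if "m \<le> k" for k
    using u_pow_tail[OF g, of k] that by (simp add: tail_zero f'_def)
  have "g2_frame scl br m N (u + v) (w + z) f'"
  proof unfold_locales
    show "f' (m - 1) \<noteq> 0" using f_last last by simp
    show "u + v \<in> N" "w + z \<in> N" "f' k \<in> N" for k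
      using u_N w_N A_subset_N assms(1) z f'_A by auto
    show "br (u + v) (u + v) = 0" "br (w + z) (w + z) = 0"
      "br (u + v) (w + z) = 0" "br (w + z) (u + v) = 0"
      using assms(1) z by (simp_all add: br_add_left br_add_right A_A A_u A_w w_A uz)
    show "br (u + v) (f' k) = f' (Suc k)" "br (f' k) (u + v) = - f' (Suc k)"
      "br (f' k) (w + z) = f' (Suc (Suc k))" "br (w + z) (f' k) = - f' (Suc (Suc k))"
      "br (f' i) (f' k) = 0" for i k
      using assms(1) z f'_A by (simp_all add: br_add_left br_add_right A_A A_u A_w w_A f'_Suc)
  qed (rule f'_zero)
  then show ?thesis by (simp add: z_def f'_def algebra_simps)
qed

lemma u_pow_f0: "(\<lambda>k. (br u ^^ k) (f 0)) = f"
  by (simp add: u_pow_f)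

lemma scale_double: "(2 * a) *s v = a *s v + a *s v"
  by (metis mult_2 scale_left_distrib)

text \<open>Since \<open>u\<close>, \<open>w\<close> and \<open>f 0\<close> generate the nilradical,
  unknown coefficients of their images are compared through the relations among them. Once the image
  of \<open>u\<close> is known, that of \<open>w\<close> is fixed up to the central term with
  coefficient \<open>c\<close>.\<close>

lemma derivation_shape: "\<exists>\<alpha> \<beta> c. br u x - \<alpha> *s u \<in> A \<and> br (f 0) x - \<beta> *s f 0 \<in> tail f 1 \<and>
    br w x = (2 * \<alpha>) *s w - br u (br u x - \<alpha> *s u) + c *s f (m - 1)"
proof -
  obtain a1 an va where Du: "br u x = a1 *s u + an *s w + va" and va: "va \<in> A"
    using N_decomp[OF br_N_left[OF u_N]] by blast
  obtain b1 bn vb where Df: "br (f 0) x = b1 *s u + bn *s w + vb" and vb: "vb \<in> A"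
    using N_decomp[OF br_N_left[OF f_N]] by blast
  obtain c1 cn vc where Dw: "br w x = c1 *s u + cn *s w + vc" and vc: "vc \<in> A"
    using N_decomp[OF br_N_left[OF w_N]] by blast
  have Df1: "br (f (Suc 0)) x = a1 *s f (Suc 0) - an *s f 2 + br u vb"
    using br_right_derivation[of u "f 0" x] va
    by (simp add: Du Df br_linear A_A numeral_2_eq_2)
  have Df2: "br (f 2) x = (2 * a1) *s f 2 - (2 * an) *s f 3 + br u (br u vb)"
    using br_right_derivation[of u "f (Suc 0)" x] va
    by (simp add: Du Df1 br_linear A_A numeral_2_eq_2 numeral_3_eq_3 scale_double)
  \<comment> \<open>The vector \<open>f 2\<close> is both \<open>[u, f 1]\<close> and
    \<open>[f 0, w]\<close>; the two computations of its image must agree.\<close>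
  have Df2': "br (f 2) x = br u (br u vb) - c1 *s f 1 + cn *s f 2"
    using br_right_derivation[of "f 0" w x] vb vc
    by (simp add: Dw Df br_linear A_A A_w numeral_2_eq_2)
  have "br (br (f 0) (f (Suc 0))) x = b1 *s f 2 - bn *s f 3"
    unfolding br_right_derivation[of "f 0" "f (Suc 0)" x]
    using vb by (simp add: Df1 Df br_linear A_A u_A numeral_2_eq_2 numeral_3_eq_3)
  then have b: "b1 *s f 2 = bn *s f 3" by simp
  have b1: "b1 = 0"
  proof (rule f_notin_tail)
    show "b1 *s f 2 \<in> tail f (Suc 2)" unfolding b by (intro tail_closed in_tail) auto
  qed (use m in auto)
  \<comment> \<open>Here \<open>4 \<le> m\<close>, that is \<open>n > 5\<close>, ensures that
    \<open>f 3\<close> is nonzero.\<close>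
  then have bn: "bn = 0" using b f_nonzero[of 3] m by simp
  have e: "c1 *s f 1 = (cn - 2 * a1) *s f 2 + (2 * an) *s f 3"
    using Df2 Df2' by (simp add: scl_linear algebra_simps)
  have c1: "c1 = 0"
  proof (rule f_notin_tail)
    show "c1 *s f 1 \<in> tail f (Suc 1)" unfolding e by (intro tail_closed in_tail) auto
  qed (use m in auto)
  then have e': "(cn - 2 * a1) *s f 2 = (- 2 * an) *s f 3" using e by (simp add: eq_neg_iff_add_eq_0)
  have "cn - 2 * a1 = 0"
  proof (rule f_notin_tail)
    show "(cn - 2 * a1) *s f 2 \<in> tail f (Suc 2)" unfolding e' by (intro tail_closed in_tail) auto
  qed (use m in auto)
  then have cn: "cn = 2 * a1" and an: "an = 0" using e' f_nonzero[of 3] m by auto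
  \<comment> \<open>As \<open>[u, w] = 0\<close>, the left side vanishes, so
    \<open>br u va + vc\<close> lies in the kernel of the shift; this is the source of
    \<open>c\<close>.\<close>
  have "br (br u w) x = br u (br u va + vc)"
    unfolding br_right_derivation[of u w x]
    using va vc by (simp add: Du Dw br_linear A_A A_w)
  then obtain c where c: "br u va + vc = c *s f (m - 1)"
    using u_ker[of "br u va + vc"] va vc u_A by auto
  obtain \<beta> t where "vb = \<beta> *s f 0 + t" "t \<in> tail f (Suc 0)" using tail_breakdownE[OF vb] by auto
  then have "br (f 0) x - \<beta> *s f 0 \<in> tail f 1" by (simp add: Df b1 bn)
  moreover have "br u x - a1 *s u = va" by (simp add: Du an)
  moreover have "vc = c *s f (m - 1) - br u va" using c by (simp add: algebra_simps)
  then have "br w x = (2 * a1) *s w - br u va + c *s f (m - 1)"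
    by (simp add: Dw c1 cn)
  ultimately show ?thesis using va by metis
qed

end

section \<open>Right multiplication by an element outside the nilradical\<close>

locale g2_extension = g2_frame scl br m N u w f
  for scl :: "complex \<Rightarrow> 'v::ab_group_add \<Rightarrow> 'v" (infixr "*s" 75)
    and br :: "'v \<Rightarrow> 'v \<Rightarrow> 'v" and m N u w f +
  fixes x :: 'v and \<alpha> \<beta> c :: complex
  assumes x_N: "x \<notin> N"
    and u_x: "br u x - \<alpha> *s u \<in> A"
    and f0_x: "br (f 0) x - \<beta> *s f 0 \<in> tail f 1"
    and w_x: "br w x = (2 * \<alpha>) *s w - br u (br u x - \<alpha> *s u) + c *s f (m - 1)"
begin

text \<open>The \<open>A\<close>-part of the image of \<open>u\<close> acts trivially on
  \<open>A\<close>. Each application of the shift therefore raises the eigenvalue by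
  \<open>\<alpha>\<close>.\<close>

lemma D_u_A:
  assumes "v \<in> A"
  shows "br (br u v) x = \<alpha> *s br u v + br u (br v x)"
proof -
  define a where "a = br u x - \<alpha> *s u"
  have "br u x = \<alpha> *s u + a" "a \<in> A" using u_x by (auto simp: a_def)
  then show ?thesis unfolding br_right_derivation[of u v x]
    using assms by (simp add: br_linear A_A)
qed

lemma D_f: "br (f k) x - (of_nat k * \<alpha> + \<beta>) *s f k \<in> tail f (Suc k)"
proof (induction k)
  case 0
  then show ?case using f0_x by simp
next
  case (Suc k)
  have "br (f (Suc k)) x - (of_nat (Suc k) * \<alpha> + \<beta>) *s f (Suc k) =
      br u (br (f k) x - (of_nat k * \<alpha> + \<beta>) *s f k)"
    using D_u_A[of "f k"] by (simp add: br_linear scl_linear algebra_simps)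
  then show ?case using u_tail[OF Suc] by simp
qed

lemma D_last: "br (f (m - 1)) x = (of_nat (m - 1) * \<alpha> + \<beta>) *s f (m - 1)"
  using D_f[of "m - 1"] m tail_zero[of "Suc (m - 1)"] by simp

lemma D_tail: "v \<in> tail f s \<Longrightarrow> br v x \<in> tail f s"
proof -
  have "br (f k) x \<in> tail f s" if "s \<le> k" for k
  proof -
    have "br (f k) x - (of_nat k * \<alpha> + \<beta>) *s f k \<in> tail f s"
      by (rule tail_antimono[OF D_f]) (use that in auto)
    from subspace_add[OF subspace_tail this subspace_scale[OF subspace_tail in_tail[OF that]]]
    show ?thesis by (metis diff_add_cancel)
  qed
  then have "tail f s \<subseteq> {v. br v x \<in> tail f s}"
    by (intro tail_subset subspace_br_left) auto
  then show "v \<in> tail f s \<Longrightarrow> ?thesis" by auto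
qed

lemma UNIV_decomp: "\<exists>k. \<exists>b\<in>N. v = k *s x + b"
  using codim_N[OF x_N, of v] by (metis add.commute diff_add_cancel)

lemma symmetric_part_central:
  assumes "v \<in> N"
  shows "\<exists>r. br x v + br v x = r *s f (m - 1)"
  by (rule N_center) (use assms in \<open>auto simp: br_N_left br_N_right br_symmetric_part_annihilates\<close>)

lemma x_x: "\<exists>r. br x x = r *s f (m - 1)"
proof (rule N_center)
  obtain k b where kb: "br x x = k *s x + b" "b \<in> N" using UNIV_decomp by blast
  \<comment> \<open>Expanding this with \<open>br x x = k *s x + b\<close> puts
    \<open>(k * k) *s x\<close> into \<open>N\<close>, which forces \<open>k = 0\<close>.\<close>
  have "br x (br x x) = 0" by (rule br_square_annihilates)
  then have "(k * k) *s x = - (k *s b) - br x b" by (simp add: kb(1) br_linear scl_linear eq_neg_iff_add_eq_0 algebra_simps)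
  also have "\<dots> \<in> N" using kb by (intro N_closed) (auto simp: br_N_right)
  finally have kx: "(k * k) *s x \<in> N" .
  have "k = 0"
  proof (rule ccontr)
    assume "k \<noteq> 0"
    then have "x = (1 / (k * k)) *s (k * k) *s x" by simp
    then show False using kx x_N subspace_scale[OF subspace_N] by metis
  qed
  then show "br x x \<in> N" using kb by simp
qed (simp add: br_square_annihilates)

text \<open>With both eigenvalues zero, every bracket lands in \<open>A\<close>, and right
  multiplication by any element moves each tail into the next. Only right multiplications matter,
  since \<open>lcs\<close> brackets the previous term on the left.\<close>

lemma nilpotent_if_zero:
  assumes "\<alpha> = 0" "\<beta> = 0"
  shows "lcs scl br UNIV (Suc k) \<subseteq> tail f k"
proof -
  have D_A: "br v x \<in> tail f (Suc s)" if "v \<in> tail f s" for v s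
  proof -
    have "br (f k) x \<in> tail f (Suc s)" if "s \<le> k" for k
      by (rule tail_antimono[of _ _ "Suc k"]) (use D_f[of k] assms that in auto)
    then have "tail f s \<subseteq> {v. br v x \<in> tail f (Suc s)}"
      by (intro tail_subset subspace_br_left) auto
    with that show ?thesis by auto
  qed
  have D_N: "br v x \<in> A" if "v \<in> N" for v
  proof -
    obtain p q a where v: "v = p *s u + q *s w + a" "a \<in> A" using N_decomp[OF \<open>v \<in> N\<close>] by auto
    have "br u x \<in> A" using u_x assms by simp
    moreover from this have "br w x \<in> A" using w_x assms u_A by simp
    moreover have "br a x \<in> A" using D_tail v by simp
    ultimately show ?thesis unfolding v(1) br_add_left br_scale_left by (intro tail_closed)
  qed
  have x_N': "br x v \<in> A" if "v \<in> N" for v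
  proof -
    obtain r where "br x v + br v x = r *s f (m - 1)" using symmetric_part_central[OF \<open>v \<in> N\<close>] by auto
    then have "br x v = r *s f (m - 1) - br v x" by (simp add: algebra_simps)
    then show ?thesis using D_N[OF that] by simp
  qed
  have br_A: "br a b \<in> A" for a b
  proof -
    obtain k a' where a: "a = k *s x + a'" "a' \<in> N" using UNIV_decomp by blast
    obtain l b' where b: "b = l *s x + b'" "b' \<in> N" using UNIV_decomp by blast
    obtain r where "br x x = r *s f (m - 1)" using x_x by auto
    then have "br x x \<in> A" by simp
    moreover have "br x b' \<in> A" by (rule x_N'[OF b(2)])
    moreover have "br a' x \<in> A" by (rule D_N[OF a(2)])
    moreover have "br a' b' \<in> A" by (rule N_br_A[OF a(2) b(2)])
    ultimately show ?thesis
      unfolding a(1) b(1) br_add_left br_add_right br_scale_left br_scale_right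
      by (intro tail_closed)
  qed
  show ?thesis
  proof (induction k)
    case 0
    have "span {br a b | a b. a \<in> UNIV \<and> b \<in> UNIV} \<subseteq> A"
      by (rule span_minimal) (auto simp: br_A)
    then show ?case by (simp add: brs_def)
  next
    case (Suc k)
    have *: "br a b \<in> tail f (Suc k)" if "a \<in> tail f k" for a b
    proof -
      obtain l b' where b: "b = l *s x + b'" "b' \<in> N" using UNIV_decomp by blast
      show ?thesis unfolding b(1) br_add_right br_scale_right
        using that b(2) by (intro tail_closed D_A N_br_tail)
    qed
    have "brs scl br (lcs scl br UNIV (Suc k)) UNIV \<subseteq> tail f (Suc k)"
      unfolding brs_def
    proof (rule span_minimal)
      show "{br a b | a b. a \<in> lcs scl br UNIV (Suc k) \<and> b \<in> UNIV} \<subseteq> tail f (Suc k)"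
        using Suc * by blast
    qed simp
    then show ?case by (metis lcs.simps(2))
  qed
qed

lemma eigenvalues_nonzero: "\<alpha> \<noteq> 0 \<or> \<beta> \<noteq> 0"
proof (rule ccontr)
  assume "\<not> ?thesis"
  then have "lcs scl br UNIV (Suc m) \<subseteq> {0}"
    using nilpotent_if_zero[of m] tail_zero[of m] by simp
  moreover have "0 \<in> lcs scl br UNIV (Suc m)" by (simp add: brs_def span_zero)
  ultimately show False using not_nilpotent[of "Suc m"] by blast
qed

section \<open>Antisymmetry of the brackets with \<open>x\<close>\<close>

lemma symmetric_part_u:
  assumes "v \<in> N"
  shows "br x (br u v) + br (br u v) x = 0"
proof -
  obtain r where r: "br x v + br v x = r *s f (m - 1)" using symmetric_part_central[OF assms] by auto
  obtain s where s: "br x u + br u x = s *s f (m - 1)" using symmetric_part_central[OF u_N] by auto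
  have r': "br x v = r *s f (m - 1) - br v x" and s': "br x u = s *s f (m - 1) - br u x"
    using r s by (simp_all add: algebra_simps)
  have "br (br v x) u = - br u (br v x)"
    using N_anticommute[OF br_N_left[OF assms] u_N] by simp
  then show ?thesis
    unfolding leibniz_identity[of x u v] br_right_derivation[of u v x] r' s'
    using last_central u_N assms by (simp add: br_linear del: One_nat_def uf fu)
qed

text \<open>The second hypothesis says that right multiplication by \<open>x\<close> kills
  \<open>f (m - 1)\<close>, so the central error terms drop out of the Leibniz identity for
  \<open>[x,[v,x]]\<close>.\<close>

lemma symmetric_part_D:
  assumes "v \<in> N" "of_nat (m - 1) * \<alpha> + \<beta> = 0"
  shows "br x (br v x) + br (br v x) x = 0"
proof -
  obtain r where r: "br x v + br v x = r *s f (m - 1)" using symmetric_part_central[OF assms(1)] by auto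
  then have r': "br x v = r *s f (m - 1) - br v x" by (simp add: algebra_simps)
  obtain s where s: "br x x = s *s f (m - 1)" using x_x by auto
  show ?thesis
    unfolding leibniz_identity[of x v x] r' s
    using last_central assms by (simp add: br_linear D_last del: One_nat_def)
qed

text \<open>Each \<open>f k\<close> with positive \<open>k\<close> is \<open>[u, f (k - 1)]\<close>,
  so \<open>symmetric_part_u\<close> applies.\<close>

lemma x_tail_anticommute: "v \<in> tail f (Suc 0) \<Longrightarrow> br x v = - br v x"
proof -
  have "br x (f k) = - br (f k) x" if "Suc 0 \<le> k" for k
    using symmetric_part_u[of "f (k - 1)"] that f_N by (simp add: eq_neg_iff_add_eq_0)
  then have "tail f (Suc 0) \<subseteq> {v. br x v = - br v x}"
    by (intro tail_subset) (auto simp: subspace_def br_linear)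
  then show "v \<in> tail f (Suc 0) \<Longrightarrow> ?thesis" by auto
qed

lemma x_last: "br x (f (m - 1)) = - ((of_nat (m - 1) * \<alpha> + \<beta>) *s f (m - 1))"
  using x_tail_anticommute[OF in_tail[of "Suc 0" "m - 1" f]] m by (simp add: D_last del: One_nat_def)

lemma x_x_zero:
  "\<exists>\<delta>. br x x = \<delta> *s f (m - 1) \<and> \<delta> * (of_nat (m - 1) * \<alpha> + \<beta>) = 0"
proof -
  obtain s where s: "br x x = s *s f (m - 1)" using x_x by auto
  have "br x (br x x) = 0" by (rule br_square_annihilates)
  then show ?thesis using s f_last by (auto simp: br_linear x_last simp del: One_nat_def)
qed

text \<open>If the eigenvalue of \<open>f (m - 1)\<close> is nonzero, bracketing the central
  symmetric part with \<open>x\<close> kills its coefficient. Otherwise the symmetric part vanishes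
  on the images of both the derivation and the shift, and these reach all of
  \<open>N\<close>.\<close>

lemma x_anticommute:
  assumes "v \<in> N"
  shows "br x v = - br v x"
proof (cases "of_nat (m - 1) * \<alpha> + \<beta> = 0")
  case False
  obtain r where r: "br x v + br v x = r *s f (m - 1)" using symmetric_part_central[OF assms] by auto
  have "br x (br x v + br v x) = 0" by (rule br_symmetric_part_annihilates)
  then have "r = 0" using False f_last by (auto simp: r br_linear x_last simp del: One_nat_def)
  with r show ?thesis by (simp add: eq_neg_iff_add_eq_0)
next
  case True
  define s where "s v = br x v + br v x" for v
  have s_add: "s (a + b) = s a + s b" and s_scale: "s (k *s a) = k *s s a" for a b k
    by (simp_all add: s_def br_linear scl_linear)
  have s_D: "s (br v x) = 0" if "v \<in> N" for v
    using symmetric_part_D[OF that True] by (simp add: s_def)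
  have s_tail: "s v = 0" if "v \<in> tail f (Suc 0)" for v
    using x_tail_anticommute[OF that] by (simp add: s_def)
  \<comment> \<open>In this case \<open>\<beta>\<close> is a nonzero multiple of
    \<open>\<alpha>\<close>, so they could only vanish together. Division by \<open>\<beta>\<close>,
    \<open>\<alpha>\<close> and \<open>2 * \<alpha>\<close> then treats \<open>f 0\<close>,
    \<open>u\<close> and \<open>w\<close> in turn.\<close>
  have \<alpha>: "\<alpha> \<noteq> 0" and \<beta>: "\<beta> \<noteq> 0" using eigenvalues_nonzero True m by auto
  obtain t where t: "br (f 0) x = \<beta> *s f 0 + t" "t \<in> tail f (Suc 0)"
    using f0_x by (metis One_nat_def add.commute diff_add_cancel)
  have "\<beta> *s s (f 0) = 0" using s_D[OF f_N[of 0]] s_tail[OF t(2)] by (simp add: t(1) s_add s_scale)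
  then have s0: "s (f 0) = 0" using \<beta> by simp
  have s_A: "s v = 0" if v: "v \<in> A" for v
  proof -
    obtain r t where "v = r *s f 0 + t" "t \<in> tail f (Suc 0)" using tail_breakdownE[OF v] by blast
    then show ?thesis by (simp add: s_add s_scale s0 s_tail)
  qed
  obtain a where a: "br u x = \<alpha> *s u + a" "a \<in> A" using u_x by (metis add.commute diff_add_cancel)
  have "\<alpha> *s s u = 0" using s_D[OF u_N] s_A[OF a(2)] by (simp add: a(1) s_add s_scale)
  then have su: "s u = 0" using \<alpha> by simp
  obtain b where b: "br w x = (2 * \<alpha>) *s w + b" "b \<in> A"
    using w_x u_A[OF u_x] by (metis (no_types, opaque_lifting) add_diff_eq diff_add_eq f_A subspace_scale subspace_tail
        subspace_diff)
  have "(2 * \<alpha>) *s s w = 0" using s_D[OF w_N] s_A[OF b(2)] by (simp add: b(1) s_add s_scale)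
  then have sw: "s w = 0" using \<alpha> by simp
  obtain p q a where "v = p *s u + q *s w + a" "a \<in> A" using N_decomp[OF assms] by auto
  then have "s v = 0" by (simp add: s_add s_scale su sw s_A)
  then show ?thesis by (simp add: s_def eq_neg_iff_add_eq_0)
qed

section \<open>Effect of changing \<open>x\<close> and the frame on the derivation data\<close>

lemma x_change:
  assumes "k \<noteq> 0" "y \<in> A"
  shows "g2_extension scl br m N u w f (k *s x + r *s u + y) (k * \<alpha>) (k * \<beta>) (k * c)"
proof -
  let ?x = "k *s x + r *s u + y"
  \<comment> \<open>The summand \<open>y\<close> affects the image of \<open>u\<close> but not that
    of \<open>f 0\<close>; the summand \<open>r *s u\<close> does the opposite.\<close>
  have u': "br u ?x - (k * \<alpha>) *s u = k *s (br u x - \<alpha> *s u) + br u y"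
    by (simp add: br_linear scl_linear)
  have f': "br (f 0) ?x - (k * \<beta>) *s f 0 = k *s (br (f 0) x - \<beta> *s f 0) - r *s f 1"
    using assms by (simp add: br_linear scl_linear A_A)
  have w': "br w ?x = (2 * (k * \<alpha>)) *s w - br u (br u ?x - (k * \<alpha>) *s u) + (k * c) *s f (m - 1)"
  proof -
    define d where "d = br u x - \<alpha> *s u"
    have "br w x = (2 * \<alpha>) *s w - br u d + c *s f (m - 1)" by (simp only: w_x d_def)
    then show ?thesis unfolding u' d_def[symmetric] using assms
      by (simp add: br_add_right br_scale_right w_A scl_linear mult.left_commute del: One_nat_def)
  qed
  show ?thesis
  proof unfold_locales
    show "?x \<notin> N"
    proof
      assume "?x \<in> N"
      moreover have "x = (1 / k) *s (?x - r *s u - y)" using assms by simp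
      ultimately show False using x_N u_N A_subset_N assms
        by (metis N_closed(2,3) subsetD)
    qed
    show "br u ?x - (k * \<alpha>) *s u \<in> A" unfolding u' using u_x u_A assms by simp
    show "br (f 0) ?x - (k * \<beta>) *s f 0 \<in> tail f 1" unfolding f'
      by (intro tail_closed f0_x in_tail) simp
  qed (rule w')
qed

text \<open>The coefficient \<open>c\<close> moves by \<open>\<nu>\<close> times the difference of
  the eigenvalues of \<open>f (m - 1)\<close> and \<open>w\<close>, so it can be removed unless
  these coincide.\<close>

lemma uw_change:
  assumes "v \<in> A" "g - f 0 \<in> tail f 1"
  shows "g2_extension scl br m N (u + v) (w - br u v + \<nu> *s f (m - 1)) (\<lambda>k. (br u ^^ k) g) x \<alpha> \<beta>
    (c + \<nu> * ((of_nat (m - 1) - 2) * \<alpha> + \<beta>))"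
proof -
  define u' w' f' where "u' = u + v" and "w' = w - br u v + \<nu> *s f (m - 1)" and "f' = (\<lambda>k. (br u ^^ k) g)"
  interpret F: g2_frame scl br m N u' w' f'
    unfolding u'_def w'_def f'_def by (rule frame_change[OF assms])
  have g: "g \<in> A"
    using subspace_add[OF subspace_tail tail_A[OF assms(2)] f_A[of 0]] by simp
  have f'_A: "f' k \<in> A" for k
    using u_pow_tail[OF g, of k] tail_A by (simp add: f'_def)
  have A'A: "tail f' 0 \<subseteq> A" by (rule tail_subset) (auto simp: f'_A)
  \<comment> \<open>The locale conditions for the new frame refer to its own tails, which are
    therefore compared with the old ones.\<close>
  have AA': "A \<subseteq> tail f' 0"
  proof
    fix a assume a: "a \<in> A"
    obtain p q b where b: "a = p *s u' + q *s w' + b" "b \<in> tail f' 0"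
      using F.N_decomp a A_subset_N by blast
    let ?r = "p *s v + q *s (\<nu> *s f (m - 1) - br u v) + b - a"
    have "p *s u + q *s w + ?r = 0"
      by (simp add: b(1) u'_def w'_def scl_linear)
    moreover have "?r \<in> A" using a b(2) A'A assms(1) by (intro tail_closed) (auto simp: u_A)
    ultimately have "p = 0" "q = 0" using uw_indep by metis+
    then show "a \<in> tail f' 0" using b by simp
  qed
  have last: "f' (m - 1) = f (m - 1)"
  proof -
    have "(br u ^^ (m - 1)) (g - f 0) \<in> tail f ((m - 1) + 1)" using assms by (intro u_pow_tail)
    then show ?thesis using m by (simp add: tail_zero u_pow_diff u_pow_f f'_def)
  qed
  have u'A: "br u' a = br u a" if "a \<in> A" for a
    using that assms by (simp add: u'_def br_linear A_A)
  have tail1: "tail f 1 \<subseteq> tail f' 1"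
  proof (rule tail_subset)
    fix k :: nat assume "1 \<le> k"
    then have "f k = br u' (f (k - 1))" by (simp add: u'A)
    moreover have "br u' (f (k - 1)) \<in> tail f' (Suc 0)"
      using AA' by (intro F.u_tail) auto
    ultimately show "f k \<in> tail f' 1" by simp
  qed simp
  have Dv: "br v x \<in> A" using D_tail assms by simp
  have u'x: "br u' x - \<alpha> *s u' = (br u x - \<alpha> *s u) + (br v x - \<alpha> *s v)"
    by (simp add: u'_def br_linear scl_linear)
  also have "\<dots> \<in> A" using u_x Dv assms by simp
  finally have u'x_A: "br u' x - \<alpha> *s u' \<in> A" .
  have g_x: "br (f' 0) x - \<beta> *s f' 0 \<in> tail f 1"
  proof -
    have "br (g - f 0) x \<in> tail f 1" using D_tail assms by simp
    then have "br (g - f 0) x - \<beta> *s (g - f 0) + (br (f 0) x - \<beta> *s f 0) \<in> tail f 1"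
      using assms(2) f0_x by (meson subspace_add subspace_diff subspace_scale subspace_tail)
    then show ?thesis by (simp add: f'_def br_linear scl_linear)
  qed
  have E1: "br u' (br u' x - \<alpha> *s u') = br u (br u x - \<alpha> *s u) + (br u (br v x) - \<alpha> *s br u v)"
    unfolding u'A[OF u'x_A] unfolding u'x by (simp add: br_linear)
  have E2: "br w' x = br w x - (\<alpha> *s br u v + br u (br v x))
      + \<nu> *s ((of_nat (m - 1) * \<alpha> + \<beta>) *s f (m - 1))"
    using assms by (simp only: w'_def br_linear D_u_A D_last)
  \<comment> \<open>Here \<open>P\<close>, \<open>Q\<close>, \<open>T\<close> and \<open>L\<close>
    stand for \<open>br u (br u x - \<alpha> *s u)\<close>, \<open>br u v\<close>,
    \<open>br u (br v x)\<close> and \<open>f (m - 1)\<close>, and \<open>r\<close> for the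
    eigenvalue of \<open>L\<close>.\<close>
  have "(2 * \<alpha>) *s w - P + c *s L - (\<alpha> *s Q + T) + \<nu> *s (r *s L) =
      (2 * \<alpha>) *s (w - Q + \<nu> *s L) - (P + (T - \<alpha> *s Q)) + (c + \<nu> * (r - 2 * \<alpha>)) *s L" for P Q T L r
    by (simp add: scl_linear right_diff_distrib scale_double[of \<alpha> Q] mult.commute[of \<nu>])
  moreover have "(of_nat (m - 1) - 2) * \<alpha> + \<beta> = of_nat (m - 1) * \<alpha> + \<beta> - 2 * \<alpha>"
    by (simp add: left_diff_distrib)
  ultimately have w'x: "br w' x = (2 * \<alpha>) *s w' - br u' (br u' x - \<alpha> *s u') +
      (c + \<nu> * ((of_nat (m - 1) - 2) * \<alpha> + \<beta>)) *s f' (m - 1)"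
    unfolding E1 E2 last w_x unfolding w'_def by simp
  show ?thesis
    unfolding u'_def[symmetric] w'_def[symmetric] f'_def[symmetric]
    by unfold_locales (use x_N u'x_A g_x AA' tail1 w'x in auto)
qed

section \<open>Solving for preimages and eigenvectors in \<open>A\<close>\<close>

lemma tail_preimage: "t \<in> tail f (Suc s) \<Longrightarrow> \<exists>y\<in>tail f s. br u y = t"
proof -
  have "subspace (br u ` tail f s)"
    unfolding subspace_def
  proof (intro conjI ballI allI)
    show "0 \<in> br u ` tail f s" by (rule image_eqI[of _ _ 0]) auto
  next
    fix a b assume "a \<in> br u ` tail f s" "b \<in> br u ` tail f s"
    then obtain a' b' where "a = br u a'" "b = br u b'" "a' \<in> tail f s" "b' \<in> tail f s" by auto
    then show "a + b \<in> br u ` tail f s"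
      by (intro image_eqI[of _ _ "a' + b'"]) (simp_all add: br_linear)
  next
    fix a k assume "a \<in> br u ` tail f s"
    then obtain a' where "a = br u a'" "a' \<in> tail f s" by auto
    then show "k *s a \<in> br u ` tail f s"
      by (intro image_eqI[of _ _ "k *s a'"]) (simp_all add: br_linear)
  qed
  then have "tail f (Suc s) \<subseteq> br u ` tail f s"
  proof (rule tail_subset)
    fix k assume "Suc s \<le> k"
    then show "f k \<in> br u ` tail f s"
      by (intro image_eqI[of _ _ "f (k - 1)"] in_tail) simp_all
  qed
  then show "t \<in> tail f (Suc s) \<Longrightarrow> ?thesis" by auto
qed

text \<open>Successive approximation: the error is pushed one tail further at each step until it is
  zero.\<close>

lemma eigenvector_exists:
  assumes "\<alpha> = 1"
  shows "\<exists>g. g - f 0 \<in> tail f 1 \<and> br g x = \<beta> *s g"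
proof -
  have "\<exists>g. g - f 0 \<in> tail f 1 \<and> br g x - \<beta> *s g \<in> tail f (Suc s)" for s
  proof (induction s)
    case 0
    show ?case by (rule exI[of _ "f 0"]) (use f0_x in simp)
  next
    case (Suc s)
    then obtain g where g: "g - f 0 \<in> tail f 1" "br g x - \<beta> *s g \<in> tail f (Suc s)" by auto
    obtain r t where t: "br g x - \<beta> *s g = r *s f (Suc s) + t" "t \<in> tail f (Suc (Suc s))"
      using tail_breakdownE[OF g(2)] by blast
    define d where "d = br (f (Suc s)) x - (of_nat (Suc s) + \<beta>) *s f (Suc s)"
    \<comment> \<open>The divisor is the gap between the eigenvalue at \<open>f (Suc s)\<close> and
      \<open>\<beta>\<close>; it is never zero.\<close>
    define \<rho> where "\<rho> = r / of_nat (Suc s)"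
    define h where "h = g - \<rho> *s f (Suc s)"
    have d: "d \<in> tail f (Suc (Suc s))" using D_f[of "Suc s"] assms by (simp add: d_def)
    have "of_nat (Suc s) \<noteq> (0 :: complex)" by (rule of_nat_neq_0)
    then have r: "\<rho> * of_nat (Suc s) = r" by (simp add: \<rho>_def del: of_nat_Suc)
    have "br (f (Suc s)) x = d + (of_nat (Suc s) + \<beta>) *s f (Suc s)" by (simp add: d_def)
    then have "br h x - \<beta> *s h =
        (br g x - \<beta> *s g) - \<rho> *s (d + of_nat (Suc s) *s f (Suc s))"
      by (simp add: h_def br_linear scl_linear mult.commute[of \<beta>] del: of_nat_Suc)
    also have "\<dots> = t - \<rho> *s d"
      unfolding t scale_right_distrib scale_scale r by simp
    also have "\<dots> \<in> tail f (Suc (Suc s))" using t d by simp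
    finally have "br h x - \<beta> *s h \<in> tail f (Suc (Suc s))" .
    moreover have h: "h - f 0 = (g - f 0) - \<rho> *s f (Suc s)" by (simp add: h_def)
    have "\<rho> *s f (Suc s) \<in> tail f 1" by (intro tail_closed in_tail) auto
    then have "h - f 0 \<in> tail f 1" unfolding h by (rule subspace_diff[OF subspace_tail g(1)])
    ultimately show ?case by blast
  qed
  from this[of m] show ?thesis using tail_zero[of "Suc m"] by auto
qed

text \<open>The derivation is unitriangular on \<open>A\<close>; the equation is solved by back
  substitution from the last tail.\<close>

lemma D_surjective:
  assumes "\<alpha> = 0" "\<beta> = 1" "b \<in> A"
  shows "\<exists>v\<in>A. br v x = b"
proof -
  have "s \<le> m \<Longrightarrow> \<forall>b\<in>tail f s. \<exists>v\<in>tail f s. br v x = b" for s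
  proof (induction s rule: inc_induct)
    case base
    then show ?case by (auto simp: tail_zero)
  next
    case (step s)
    show ?case
    proof
      fix b assume "b \<in> tail f s"
      then obtain r t where t: "b = r *s f s + t" "t \<in> tail f (Suc s)" by (rule tail_breakdownE)
      define d where "d = br (f s) x - f s"
      have "d \<in> tail f (Suc s)" using D_f[of s] assms by (simp add: d_def)
      then obtain v where v: "v \<in> tail f (Suc s)" "br v x = t - r *s d" using step.IH t(2) by fastforce
      have "br (f s) x = f s + d" by (simp add: d_def)
      then have "br (r *s f s + v) x = b" by (simp add: br_linear v(2) t(1) scl_linear)
      moreover have "r *s f s + v \<in> tail f s" using tail_antimono[OF v(1), of s] by (simp add: in_tail)
      ultimately show "\<exists>v\<in>tail f s. br v x = b" by blast
    qed
  qed
  from this[of 0] assms show ?thesis by auto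
qed

lemma eigenvectors:
  assumes "\<alpha> = 1" "br (f 0) x = \<beta> *s f 0"
  shows "br (f k) x = (of_nat k + \<beta>) *s f k"
proof (induction k)
  case 0
  then show ?case using assms by simp
next
  case (Suc k)
  show ?case using D_u_A[of "f k"] assms Suc by (simp add: br_linear scl_linear)
qed

section \<open>Normal forms for zero and for nonzero \<open>\<alpha>\<close>\<close>

lemma normal_form_degenerate:
  assumes "\<alpha> = 0"
  shows "\<exists>u' w' x'. g2_extension scl br m N u' w' f x' 0 1 0 \<and>
    br u' x' = 0 \<and> br w' x' = 0 \<and> br (f 0) x' - f 0 \<in> tail f 2"
proof -
  have \<beta>: "\<beta> \<noteq> 0" using eigenvalues_nonzero assms by simp
  obtain r t where t: "br (f 0) x - \<beta> *s f 0 = r *s f (Suc 0) + t" "t \<in> tail f (Suc (Suc 0))"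
    using tail_breakdownE[of "br (f 0) x - \<beta> *s f 0" "Suc 0"] f0_x by auto
  \<comment> \<open>Since \<open>[f 0, u] = - f 1\<close>, the summand in \<open>u\<close> cancels
    the coefficient \<open>r\<close>.\<close>
  define x' where "x' = (1 / \<beta>) *s x + (r / \<beta>) *s u + 0"
  interpret X: g2_extension scl br m N u w f x' 0 1 "1 / \<beta> * c"
    using x_change[of "1 / \<beta>" 0 "r / \<beta>"] \<beta> assms by (simp add: x'_def)
  have "br (f 0) x = \<beta> *s f 0 + r *s f (Suc 0) + t" using t(1) by (simp add: algebra_simps)
  then have "br (f 0) x' - f 0 = (1 / \<beta>) *s t"
    using \<beta> by (simp add: x'_def br_linear scl_linear)
  then have f0: "br (f 0) x' - f 0 \<in> tail f 2" using t(2) by (simp add: numeral_2_eq_2)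
  have "- br u x' \<in> A" using X.u_x by simp
  then obtain v where v: "v \<in> A" "br v x' = - br u x'" using X.D_surjective by blast
  \<comment> \<open>For eigenvalues \<open>0\<close> and \<open>1\<close> the factor of
    \<open>\<nu>\<close> in \<open>uw_change\<close> is \<open>1\<close>.\<close>
  define \<nu> where "\<nu> = - (1 / \<beta> * c)"
  define u' w' where "u' = u + v" and "w' = w - br u v + \<nu> *s f (m - 1)"
  interpret Y: g2_extension scl br m N u' w' f x' 0 1 0
    using X.uw_change[OF v(1), of "f 0" \<nu>] by (simp add: u_pow_f0 u'_def w'_def \<nu>_def)
  have "br u' x' = 0" using v by (simp add: u'_def br_linear)
  moreover from this have "br w' x' = 0" using Y.w_x by simp
  ultimately show ?thesis using f0 Y.g2_extension_axioms by blast
qed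

text \<open>In order: scale \<open>x\<close>, replace \<open>f 0\<close> by an eigenvector, correct
  \<open>x\<close> by an element of \<open>A\<close> so that only the first component of the image
  of \<open>u\<close> survives, then adjust \<open>u\<close> and \<open>w\<close>. The exceptions
  are coinciding eigenvalues of \<open>u\<close> and \<open>f 0\<close>, or of \<open>w\<close> and
  \<open>f (m - 1)\<close>.\<close>

lemma normal_form_regular:
  assumes "\<alpha> \<noteq> 0"
  shows "\<exists>u' w' f' x' \<beta>' c' a. g2_extension scl br m N u' w' f' x' 1 \<beta>' c' \<and>
    br u' x' = u' + a *s f' 0 \<and> (\<beta>' \<noteq> 1 \<longrightarrow> a = 0) \<and>
    br (f' 0) x' = \<beta>' *s f' 0 \<and> (\<beta>' \<noteq> 3 - of_nat m \<longrightarrow> c' = 0)"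
proof -
  define x1 b c1 where "x1 = (1 / \<alpha>) *s x + 0 *s u + 0" and "b = 1 / \<alpha> * \<beta>" and "c1 = 1 / \<alpha> * c"
  interpret X1: g2_extension scl br m N u w f x1 1 b c1
    using x_change[of "1 / \<alpha>" 0 0] assms by (simp add: x1_def b_def c1_def)
  obtain g where g: "g - f 0 \<in> tail f 1" "br g x1 = b *s g" using X1.eigenvector_exists by auto
  define f' where "f' = (\<lambda>k. (br u ^^ k) g)"
  have g': "f' 0 = g" by (simp add: f'_def)
  interpret X2: g2_extension scl br m N u w f' x1 1 b c1
    using X1.uw_change[OF _ g(1), of 0 0] by (simp add: f'_def)
  have "br u x1 - u \<in> tail f' 0" using X2.u_x by simp
  then obtain a t where t: "br u x1 - u = a *s f' 0 + t" "t \<in> tail f' (Suc 0)"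
    by (rule X2.tail_breakdownE)
  obtain y where y: "y \<in> tail f' 0" "br u y = t" using X2.tail_preimage[OF t(2)] by auto
  define x' where "x' = 1 *s x1 + 0 *s u + - y"
  interpret X3: g2_extension scl br m N u w f' x' 1 b c1
    using X2.x_change[of 1 "- y" 0] y by (simp add: x'_def)
  have "br u x1 = u + a *s f' 0 + t" using t(1) by (simp add: algebra_simps)
  then have u_x': "br u x' = u + a *s f' 0" using y(2) by (simp add: x'_def br_linear)
  \<comment> \<open>Correcting \<open>x\<close> inside the abelian \<open>A\<close> leaves the
    eigenvector intact.\<close>
  have f_x': "br (f' 0) x' = b *s f' 0" using X2.A_A[OF X2.f_A[of 0] y(1)] g(2) g'
    by (simp add: x'_def br_linear)
  \<comment> \<open>Both \<open>\<mu>\<close> and \<open>\<nu>\<close> solve a linear equation whose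
    coefficient is an eigenvalue difference; at a resonance they default to \<open>0\<close> and the
    coefficient stays.\<close>
  define \<mu> where "\<mu> = (if b = 1 then 0 else - a / (b - 1))"
  define \<nu> where "\<nu> = (if b = 3 - of_nat m then 0 else - c1 / (of_nat m - 3 + b))"
  define u' w' where "u' = u + \<mu> *s f' 0" and "w' = w - br u (\<mu> *s f' 0) + \<nu> *s f' (m - 1)"
  define c' where "c' = c1 + \<nu> * (of_nat m - 3 + b)"
  have "of_nat (m - 1) = (of_nat m - 1 :: complex)" using m by (simp add: of_nat_diff)
  then have "g2_extension scl br m N u' w' f' x' 1 b c'"
    using X3.uw_change[of "\<mu> *s f' 0" "f' 0" \<nu>]
    by (simp add: X2.u_pow_f0 u'_def w'_def c'_def del: X2.uf)
  moreover have "br u' x' = u' + (a + \<mu> * (b - 1)) *s f' 0"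
    by (simp add: u'_def br_linear u_x' f_x' scl_linear right_diff_distrib)
  moreover have "b \<noteq> 1 \<longrightarrow> a + \<mu> * (b - 1) = 0" by (simp add: \<mu>_def field_simps)
  moreover have "of_nat m - 3 + b \<noteq> 0" if "b \<noteq> 3 - of_nat m"
  proof
    assume "of_nat m - 3 + b = 0"
    then have "b = 3 - of_nat m" by (simp add: algebra_simps add_eq_0_iff)
    with that show False by simp
  qed
  then have "b \<noteq> 3 - of_nat m \<longrightarrow> c' = 0" by (simp add: c'_def \<nu>_def)
  ultimately show ?thesis using f_x' by blast
qed

section \<open>Reading off the families from the normal forms\<close>

lemma x_bracketsI:
  assumes "\<And>k. k < m \<Longrightarrow> D (k + 2) = br (f k) x" "D 1 = br u x" "D (m + 2) = br w x"
    "br x x = xx"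
  shows "x_brackets br (m + 2) (standard_basis (m + 2) u w f) x D xx"
  unfolding x_brackets_def
proof (intro conjI ballI)
  fix i assume i: "i \<in> {1..m + 2}"
  have N: "standard_basis (m + 2) u w f i \<in> N"
    using u_N w_N f_N by (simp add: standard_basis_def)
  from i consider "i = 1" | "i = m + 2" | k where "i = k + 2" "k < m"
    by (cases "i = 1"; cases "i = m + 2") (auto intro: that(3)[of "i - 2"])
  then show D: "br (standard_basis (m + 2) u w f i) x = D i"
    by cases (use assms m in \<open>auto simp: standard_basis_def\<close>)
  show "br x (standard_basis (m + 2) u w f i) = - D i"
    using x_anticommute[OF N] D by simp
qed (rule assms(4))

lemma standard_basis_extends:
  defines "e \<equiv> standard_basis (m + 2) u w f"
  shows "x \<notin> e ` {1..m + 2}" "independent (insert x (e ` {1..m + 2}))"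
    "span (insert x (e ` {1..m + 2})) = UNIV"
proof -
  have e: "independent (e ` {1..m + 2})" "span (e ` {1..m + 2}) = N"
    using g2_basis_standard_basis by (auto simp: g2_basis_def e_def)
  show "x \<notin> e ` {1..m + 2}" using x_N e(2) span_base by blast
  show "independent (insert x (e ` {1..m + 2}))"
    using x_N e by (simp add: independent_insert)
  show "span (insert x (e ` {1..m + 2})) = UNIV"
    using codim_N[OF x_N] e by (auto simp: span_breakdown_eq)
qed

lemma classification_degenerate:
  assumes "\<alpha> = 0" "\<beta> = 1" "br u x = 0" "br w x = 0" "br (f 0) x - f 0 \<in> tail f 2"
  shows "\<exists>b. R1 scl br (m + 2) (standard_basis (m + 2) u w f) x b"
proof -
  obtain p where p: "br (f 0) x - f 0 = (\<Sum>j=2..<m. p j *s f j)"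
    using tail_sum[OF assms(5), of m] f_zero by blast
  have D: "br (f k) x = f k + (\<Sum>j=2..<m. p j *s f (k + j))" for k
  proof (induction k)
    case 0
    then show ?case using p by (simp add: algebra_simps)
  next
    case (Suc k)
    have "br u (\<Sum>j\<in>J. p j *s f (k + j)) = (\<Sum>j\<in>J. p j *s f (Suc k + j))" if "finite J" for J
      using that by (induction J rule: finite_induct) (simp_all add: br_linear)
    then show ?case using D_u_A[of "f k"] assms(1) Suc by (simp add: br_linear)
  qed
  \<comment> \<open>\<open>R1\<close> indexes its parameters by \<open>t - i + 2\<close>, two more
    than the distance \<open>j = t - i\<close> that indexes \<open>p\<close>.\<close>
  define b where "b s = p (s - 2)" for s
  have "x_brackets br (m + 2) (standard_basis (m + 2) u w f) x
     (\<lambda>i. if 2 \<le> i \<and> i \<le> m + 2 - 1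
          then standard_basis (m + 2) u w f i +
            (\<Sum>t = i + 2..m + 2 - 1. b (t - i + 2) *s standard_basis (m + 2) u w f t)
          else 0) 0"
  proof (rule x_bracketsI)
    fix k assume k: "k < m"
    have "(\<Sum>t = k + 2 + 2..m + 2 - 1. b (t - (k + 2) + 2) *s standard_basis (m + 2) u w f t) =
        (\<Sum>j\<in>{2..<m - k}. p j *s f (k + j))"
      using k by (intro sum.reindex_bij_witness[of _ "\<lambda>j. k + j + 2" "\<lambda>t. t - (k + 2)"])
        (auto simp: b_def standard_basis_def)
    \<comment> \<open>The added terms have \<open>k + j\<close> at least \<open>m\<close> and
      vanish.\<close>
    also have "\<dots> = (\<Sum>j=2..<m. p j *s f (k + j))"
      by (rule sum.mono_neutral_left) (auto simp: f_zero)
    finally show "(if 2 \<le> k + 2 \<and> k + 2 \<le> m + 2 - 1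
          then standard_basis (m + 2) u w f (k + 2) +
            (\<Sum>t = k + 2 + 2..m + 2 - 1. b (t - (k + 2) + 2) *s standard_basis (m + 2) u w f t)
          else 0) = br (f k) x"
      using k unfolding D by (simp add: standard_basis_def)
  next
    show "br x x = 0" using x_x_zero assms by auto
  qed (use assms in auto)
  then show ?thesis unfolding R1_def by blast
qed

lemma classification_regular:
  assumes "\<alpha> = 1" "br u x = u + a *s f 0" "\<beta> \<noteq> 1 \<longrightarrow> a = 0"
    "br (f 0) x = \<beta> *s f 0" "\<beta> \<noteq> 3 - of_nat m \<longrightarrow> c = 0"
  defines "n \<equiv> m + 2" and "e \<equiv> standard_basis (m + 2) u w f"
  shows "(\<exists>a2. R2 scl br n e x a2) \<or> (\<exists>\<gamma>. R3 scl br n e x \<gamma>) \<or> (\<exists>\<delta>. R4 scl br n e x \<delta>) \<or>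
    (\<exists>b2. R5 scl br n e x b2)"
proof -
  have e1: "e 1 = u" and en: "e n = w" and ek: "k < m \<Longrightarrow> e (k + 2) = f k" for k
    by (auto simp: e_def n_def standard_basis_def)
  have e': "e (Suc 0) = u" "e (Suc (Suc m)) = w" "k < m \<Longrightarrow> e (Suc (Suc k)) = f k" for k
    using e1 en ek by (auto simp: n_def)
  have e2: "e 2 = f 0" and e3: "e 3 = f 1" and el: "e (n - 1) = f (m - 1)"
    using ek[of 0] ek[of 1] ek[of "m - 1"] m by (auto simp: n_def numeral_2_eq_2 numeral_3_eq_3)
  note D = eigenvectors[OF assms(1,4)]
  have w: "br w x = 2 *s w - a *s f 1 + c *s f (m - 1)"
    using w_x assms by (simp add: br_linear)
  have m1: "of_nat (m - 1) = (of_nat m - 1 :: complex)" using m by (simp add: of_nat_diff)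
  obtain \<delta> where \<delta>: "br x x = \<delta> *s f (m - 1)" "\<delta> * (of_nat m - 1 + \<beta>) = 0"
    using x_x_zero assms(1) m1 by auto
  \<comment> \<open>This makes the exceptional values \<open>1\<close>, \<open>3 - m\<close> and
    \<open>1 - m\<close> of \<open>\<beta>\<close> distinct, so at most one of \<open>a\<close>,
    \<open>c\<close> and \<open>\<delta>\<close> survives. In terms of \<open>n\<close> the last two
    are \<open>5 - n\<close> and \<open>3 - n\<close>.\<close>
  have of_nat_m: "of_nat m \<noteq> (2 :: complex)" "of_nat m \<noteq> (0 :: complex)"
    using m of_nat_eq_iff[of m 2, where ?'a = complex] by auto
  consider "\<beta> = 1" | "\<beta> = 3 - of_nat m" | "\<beta> = 1 - of_nat m" |
    "\<beta> \<notin> {1, 3 - of_nat m, 1 - of_nat m}" by blast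
  then show ?thesis
  proof cases
    case 1
    then have "c = 0" using assms(5) of_nat_m by (auto simp: algebra_simps)
    moreover have "\<delta> = 0" using \<delta> 1 of_nat_m by simp
    ultimately have "R2 scl br n e x a"
      unfolding R2_def n_def e_def
      by (intro x_bracketsI, fold e_def n_def)
        (use m 1 \<delta> in \<open>auto simp: D w assms(2) e' e2 e3 n_def add.commute[of 1]\<close>)
    then show ?thesis by blast
  next
    case 2
    then have "a = 0" using assms(3) of_nat_m by (auto simp: algebra_simps)
    moreover have "\<delta> = 0" using \<delta> 2 by simp
    ultimately have "R3 scl br n e x c"
      unfolding R3_def n_def e_def
      by (intro x_bracketsI, fold e_def n_def)
        (use m 2 \<delta> in \<open>auto simp: D w assms(2) e' el[unfolded n_def, simplified] n_def add_diff_eq\<close>)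
    then show ?thesis by blast
  next
    case 3
    then have "a = 0" "c = 0" using assms(3,5) of_nat_m by (auto simp: algebra_simps)
    then have "R4 scl br n e x \<delta>"
      unfolding R4_def n_def e_def
      by (intro x_bracketsI, fold e_def n_def)
        (use m 3 \<delta> in \<open>auto simp: D w assms(2) e' el[unfolded n_def, simplified] n_def\<close>)
    then show ?thesis by blast
  next
    case 4
    then have "of_nat m - 1 + \<beta> \<noteq> 0" by (auto simp: algebra_simps)
    then have "\<delta> = 0" using \<delta>(2) by simp
    moreover from 4 have "a = 0" "c = 0" using assms(3,5) by auto
    moreover have "\<beta> \<notin> {1, 5 - of_nat n, 3 - of_nat n}" using 4 by (auto simp: n_def)
    ultimately have "R5 scl br n e x \<beta>"
      unfolding R5_def n_def e_def
      by (intro conjI x_bracketsI, fold e_def n_def)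
        (use m \<delta> in \<open>auto simp: D w assms(2) e' n_def\<close>)
    then show ?thesis by blast
  qed
qed

end

section \<open>Assembling the two cases\<close>

context g2_frame
begin

lemma classification:
  assumes "x \<notin> N"
  shows "\<exists>e x. g2_basis scl br (m + 2) N e \<and> x \<notin> e ` {1..m + 2} \<and>
     \<not> dependent (insert x (e ` {1..m + 2})) \<and> span (insert x (e ` {1..m + 2})) = UNIV \<and>
     ((\<exists>b. R1 scl br (m + 2) e x b) \<or> (\<exists>a2. R2 scl br (m + 2) e x a2) \<or>
      (\<exists>\<gamma>. R3 scl br (m + 2) e x \<gamma>) \<or> (\<exists>\<delta>. R4 scl br (m + 2) e x \<delta>) \<or>
      (\<exists>b2. R5 scl br (m + 2) e x b2))"
proof -
  obtain \<alpha> \<beta> c where "br u x - \<alpha> *s u \<in> A" "br (f 0) x - \<beta> *s f 0 \<in> tail f 1"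
    "br w x = (2 * \<alpha>) *s w - br u (br u x - \<alpha> *s u) + c *s f (m - 1)"
    using derivation_shape by blast
  then interpret X: g2_extension scl br m N u w f x \<alpha> \<beta> c
    using assms by unfold_locales
  show ?thesis
  proof (cases "\<alpha> = 0")
    case True
    then obtain u' w' x' where Y: "g2_extension scl br m N u' w' f x' 0 1 0" and
      Y': "br u' x' = 0" "br w' x' = 0" "br (f 0) x' - f 0 \<in> tail f 2"
      using X.normal_form_degenerate by blast
    interpret Y: g2_extension scl br m N u' w' f x' 0 1 0 by (rule Y)
    show ?thesis
      using Y.g2_basis_standard_basis Y.standard_basis_extends Y.classification_degenerate[OF refl refl Y']
      by blast
  next
    case False
    then obtain u' w' f' x' \<beta>' c' a where Y: "g2_extension scl br m N u' w' f' x' 1 \<beta>' c'" and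
      Y': "br u' x' = u' + a *s f' 0" "\<beta>' \<noteq> 1 \<longrightarrow> a = 0" "br (f' 0) x' = \<beta>' *s f' 0"
        "\<beta>' \<noteq> 3 - of_nat m \<longrightarrow> c' = 0"
      using X.normal_form_regular by blast
    interpret Y: g2_extension scl br m N u' w' f' x' 1 \<beta>' c' by (rule Y)
    show ?thesis
      using Y.g2_basis_standard_basis Y.standard_basis_extends Y.classification_regular[OF refl Y']
      by blast
  qed
qed

end

section \<open>From the nilradical hypotheses to a frame\<close>

theorem theorem3p4:
  fixes scl :: "complex \<Rightarrow> 'v::ab_group_add \<Rightarrow> 'v"
    and br :: "'v \<Rightarrow> 'v \<Rightarrow> 'v"
    and n :: nat and N :: "'v set"
  assumes "n > 5"
    and "leibniz_algebra scl br"
    and "vector_space.dim scl (UNIV :: 'v set) = n + 1"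
    and "solvable_alg scl br"
    and "is_nilradical scl br N"
    and "isomorphic_g2 scl br n N"
  shows "\<exists>e x. g2_basis scl br n N e \<and> x \<notin> e ` {1..n} \<and>
           \<not> module.dependent scl (insert x (e ` {1..n})) \<and>
           module.span scl (insert x (e ` {1..n})) = UNIV \<and>
           ((\<exists>b. R1 scl br n e x b) \<or> (\<exists>a2. R2 scl br n e x a2) \<or>
            (\<exists>\<gamma>. R3 scl br n e x \<gamma>) \<or> (\<exists>\<delta>. R4 scl br n e x \<delta>) \<or>
            (\<exists>b2. R5 scl br n e x b2))"
proof -
  interpret leibniz scl br
    using assms(2) by (auto simp: leibniz_algebra_def leibniz_def leibniz_axioms_def)
  define m where "m = n - 2"
  have m: "4 \<le> m" and n: "n = m + 2" using assms(1) by (auto simp: m_def)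
  obtain e0 where e0: "g2_basis scl br n N e0" using assms(6) by (auto simp: isomorphic_g2_def)
  define E where "E = e0 ` {1..n}"
  have E: "finite E" "card E = n" "independent E" "span E = N"
    using e0 by (auto simp: E_def g2_basis_def card_image)
  obtain B where B: "independent B" "UNIV \<subseteq> span B" "card B = dim UNIV"
    using basis_exists[of UNIV] by blast
  then have B': "card B = n + 1" "finite B" using assms(3) card.infinite by fastforce+
  have N_UNIV: "N \<noteq> UNIV"
    using independent_span_bound[OF E(1) B(1)] E(2,4) B' by auto
  then obtain x where x: "x \<notin> N" by auto
  have nil: "nilpotent_ideal scl br N" and max: "nilpotent_ideal scl br J \<Longrightarrow> N \<subseteq> J \<Longrightarrow> J = N" for J
    using assms(5) by (auto simp: is_nilradical_def)
  interpret ambient scl br m N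
  proof unfold_locales
    show "subspace N" "\<And>a b. a \<in> N \<Longrightarrow> br a b \<in> N" "\<And>a b. a \<in> N \<Longrightarrow> br b a \<in> N"
      using nil by (auto simp: nilpotent_ideal_def is_ideal_def)
    show "\<exists>E. finite E \<and> card E = m + 2 \<and> span E = N" using E n by auto
    show "lcs scl br UNIV k \<noteq> {0}" for k
    proof
      assume "lcs scl br UNIV k = {0}"
      \<comment> \<open>A nilpotent whole algebra would be a nilpotent ideal properly containing
        \<open>N\<close>, against maximality.\<close>
      then have "nilpotent_ideal scl br UNIV"
        by (auto simp: nilpotent_ideal_def is_ideal_def)
      then show False using max[of UNIV] N_UNIV by auto
    qed
    show "\<exists>k. v - scl k x \<in> N" if "x \<notin> N" for x v
    proof -
      have "x \<notin> E" using that E(4) span_base by blast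
      \<comment> \<open>Adding \<open>x\<close> to a basis of \<open>N\<close> gives
        \<open>n + 1\<close> independent vectors, as many as a basis of the whole space.\<close>
      then have "span (insert x E) = span B"
        using that E B B' by (intro independent_span_eq) (auto simp: independent_insert)
      then have "v \<in> span (insert x E)" using B(2) by auto
      then show ?thesis using E(4) by (simp add: span_breakdown_eq)
    qed
  qed (rule m)
  define f where "f k = (if k < m then e0 (k + 2) else 0)" for k
  have br_e0: "br (e0 i) (e0 j) = g2_br n e0 i j" if "i \<in> {1..n}" "j \<in> {1..n}" for i j
    using e0 that by (auto simp: g2_basis_def)
  have e0_N: "e0 i \<in> N" if "i \<in> {1..n}" for i
    using E(4) that span_base[of "e0 i" E] by (auto simp: E_def)
  interpret g2_frame scl br m N "e0 1" "e0 n" f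
  proof unfold_locales
    have "e0 (m - 1 + 2) \<in> E" using n by (auto simp: E_def)
    then show "f (m - 1) \<noteq> 0" using E(3) m dependent_zero by (auto simp: f_def)
  qed (use m e0_N in \<open>auto simp: f_def n br_e0 g2_br_def numeral_2_eq_2\<close>)
  show ?thesis unfolding n using classification[OF x] .
qed

end
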